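(* Let $T\ge 1$ be an integer and let $X_t(\theta)=\Gamma(\theta)+N_t(\theta)$, $\theta\in[-\pi,\pi]$, $t=0,\dots,T$, be the perfectly aligned noisy curve model described in the context, with $\sigma_j^2>0$ for all $j$. Let $F_j^t$ ($j\ge 0$) and $G_j^t$ ($j\ge 1$) be the random Fourier coefficients of $X_t$, with values in $\mathbb{R}^2$. Then the following hold. (1) The maximum likelihood estimators of the Fourier coefficients $\mu_j,\nu_j$ of $\Gamma$ are $$\hat\mu_j=\frac1{T+1}\sum_{t=0}^T F_j^t,\quad j\in\mathbb{N}\cup\{0\},\qquad \hat\nu_j=\frac1{T+1}\sum_{t=0}^T G_j^t,\quad j\in\mathbb{N}.$$ They are mutually independent and consistent (as $T\to\infty$), and they are normally distributed with mean vectors $\mu_j$ and $\nu_j$, respectively, and covariance matrix $\sigma_j^2 I_2/(T+1)$, where $I_2$ is the $2\times2$ identity matrix. (2) For $j\in\mathbb{N}$, the maximum likelihood estimator of $\sigma_j^2$ is $$\hat\sigma_j^2=\frac1{4(T+1)}\sum_{t=0}^T\left[\|F_j^t-\hat\mu_j\|^2+\|G_j^t-\hat\nu_j\|^2\right].$$ It is consistent (as $T\to\infty$), and $4(T+1)\hat\sigma_j^2/\sigma_j^2$ is $\chi^2$ distributed with $4T$ degrees of freedom. (3) The maximum likelihood estimator of $\sigma_0^2$ is $$\hat\sigma_0^2=\frac1{2(T+1)}\sum_{t=0}^T\|F_0^t-\hat\mu_0\|^2.$$ It is consistent (as $T\to\infty$), and $2(T+1)\hat\sigma_0^2/\sigma_0^2$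 is $\chi^2$ distributed with $2T$ degrees of freedom.
   Context: Model. $\Gamma=(\Gamma_1,\Gamma_2):[-\pi,\pi]\to\mathbb{R}^2$ is an unknown $C^1$ function with $\Gamma(-\pi)=\Gamma(\pi)$. Its Fourier coefficients are the vectors $\mu_0=\frac1{2\pi}\int_{-\pi}^\pi\Gamma(\theta)\,d\theta$, $\mu_j=\frac1\pi\int_{-\pi}^\pi\Gamma(\theta)\cos(j\theta)\,d\theta$, $\nu_j=\frac1\pi\int_{-\pi}^\pi\Gamma(\theta)\sin(j\theta)\,d\theta$, $j\in\mathbb{N}=\{1,2,\dots\}$ (integrals componentwise). Noise. The processes $N_t=(N_{t,1},N_{t,2})$ are independent over $t$, with $$N_{t,i}(\theta)=\sum_{j=0}^\infty\left[A_{j,i}^t\cos(j\theta)+B_{j,i}^t\sin(j\theta)\right],\quad i=1,2,$$ where all $A_{j,i}^t,B_{j,i}^t$ are mutually independent zero-mean Gaussian random variables, $A^t_{j,i}$ and $B^t_{j,i}$ having variance $\sigma_j^2$, and for some $\epsilon>0$, $\sum_{j\ge1}j^{2+\epsilon}\sigma_j^2<\infty$. The $N_{t,i}$ are taken in their continuously differentiable version. Write $A_j^t=(A_{j,1}^t,A_{j,2}^t)$, $B_j^t=(B_{j,1}^t,B_{j,2}^t)$. Random Fourier coefficients: $F_0^t=\frac1{2\pi}\int_{-\pi}^\pi X_t(\theta)\,d\theta=\mu_0+A_0^t$, and for $j\in\mathbb{N}$, $F_j^t=\frac1\pi\int_{-\pi}^\pi X_t(\theta)\cos(j\theta)\,d\theta=\mu_j+A_j^t$,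 $G_j^t=\frac1\pi\int_{-\pi}^\pi X_t(\theta)\sin(j\theta)\,d\theta=\nu_j+B_j^t$. Likelihood. "Maximum likelihood" refers, for any cut-off order $J\in\mathbb{N}$, to the joint Gaussian likelihood of the coefficients $F_0^t,F_j^t,G_j^t$, $1\le j\le J$, $0\le t\le T$, with free parameters $\mu_j,\nu_j\in\mathbb{R}^2$ and $\sigma_j^2>0$; up to constants the log likelihood at observed values $f_j^t,g_j^t$ is $$-\sum_{t=0}^T\Big[\log\sigma_0^2+\sum_{j=1}^J2\log\sigma_j^2\Big]-\frac12\sum_{t=0}^T\frac{\|f_0^t-\mu_0\|^2}{\sigma_0^2}-\frac12\sum_{t=0}^T\sum_{j=1}^J\frac{\|f_j^t-\mu_j\|^2+\|g_j^t-\nu_j\|^2}{\sigma_j^2}.$$ $\|\cdot\|$ is the Euclidean norm on $\mathbb{R}^2$. *)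

theory Defs
  imports "HOL-Probability.Probability"
begin

(* The library's C1_differentiable_on asks for two-sided derivatives, hence depends on
   values outside S; here the derivative at the end points of an interval is one-sided. *)
definition C1_within :: "(real \<Rightarrow> 'b::real_normed_vector) \<Rightarrow> real set \<Rightarrow> bool" where
  "C1_within f S \<longleftrightarrow>
     (\<exists>D. (\<forall>x\<in>S. (f has_vector_derivative D x) (at x within S)) \<and> continuous_on S D)"

definition fourier_cos :: "(real \<Rightarrow> real^2) \<Rightarrow> nat \<Rightarrow> real^2" where
  "fourier_cos f j =
     (if j = 0 then 1 / (2 * pi) else 1 / pi) *\<^sub>R
       integral {-pi..pi} (\<lambda>\<theta>. cos (real j * \<theta>) *\<^sub>R f \<theta>)"

definition fourier_sin :: "(real \<Rightarrow> real^2) \<Rightarrow> nat \<Rightarrow> real^2" where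
  "fourier_sin f j =
     (1 / pi) *\<^sub>R integral {-pi..pi} (\<lambda>\<theta>. sin (real j * \<theta>) *\<^sub>R f \<theta>)"

(* Meaningful for symmetric positive definite S only. *)
definition mvnormal_density :: "real^'n \<Rightarrow> real^'n^'n \<Rightarrow> real^'n \<Rightarrow> real" where
  "mvnormal_density m S x =
     exp (- ((x - m) \<bullet> (matrix_inv S *v (x - m))) / 2) / sqrt ((2 * pi) ^ CARD('n) * det S)"

definition chi_square_density :: "nat \<Rightarrow> real \<Rightarrow> real" where
  "chi_square_density k x =
     (if x > 0
      then x powr (real k / 2 - 1) * exp (- x / 2) / (2 powr (real k / 2) * Gamma (real k / 2))
      else 0)"

definition (in prob_space) consistent_estimator ::
    "(nat \<Rightarrow> 'a \<Rightarrow> 'b::metric_space) \<Rightarrow> 'b \<Rightarrow> bool" where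
  "consistent_estimator est \<theta> \<longleftrightarrow>
     (\<forall>T. est T \<in> borel_measurable M) \<and>
     (\<forall>e>0. (\<lambda>T. prob {\<omega> \<in> space M. dist (est T \<omega>) \<theta> > e}) \<longlonglongrightarrow> 0)"

(* f t j and g t j are the observed cosine and sine coefficients of order j at time t;
   v j is the variance, so mat (v j) is the covariance matrix v j * I_2. *)
definition likelihood ::
    "nat \<Rightarrow> nat \<Rightarrow> (nat \<Rightarrow> nat \<Rightarrow> real^2) \<Rightarrow> (nat \<Rightarrow> nat \<Rightarrow> real^2) \<Rightarrow>
     (nat \<Rightarrow> real^2) \<Rightarrow> (nat \<Rightarrow> real^2) \<Rightarrow> (nat \<Rightarrow> real) \<Rightarrow> real" where
  "likelihood T J f g m n v =
     (\<Prod>t=0..T. mvnormal_density (m 0) (mat (v 0)) (f t 0) *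
        (\<Prod>j=1..J. mvnormal_density (m j) (mat (v j)) (f t j) *
                   mvnormal_density (n j) (mat (v j)) (g t j)))"

(* Parameters are functions on all of nat, but only m j, v j for j <= J and n j for
   1 <= j <= J enter. *)
definition is_mle ::
    "nat \<Rightarrow> nat \<Rightarrow> (nat \<Rightarrow> nat \<Rightarrow> real^2) \<Rightarrow> (nat \<Rightarrow> nat \<Rightarrow> real^2) \<Rightarrow>
     (nat \<Rightarrow> real^2) \<Rightarrow> (nat \<Rightarrow> real^2) \<Rightarrow> (nat \<Rightarrow> real) \<Rightarrow> bool" where
  "is_mle T J f g m n v \<longleftrightarrow>
     (\<forall>j\<le>J. v j > 0) \<and>
     (\<forall>m' n' v'. (\<forall>j\<le>J. v' j > 0) \<longrightarrow>
        likelihood T J f g m' n' v' \<le> likelihood T J f g m n v)"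

lemma matrix_inv_mat:
  assumes "c \<noteq> (0::real)"
  shows "matrix_inv (mat c :: real^'n^'n) = mat (1 / c)"
proof -
  have *: "(mat a :: real^'n^'n) ** mat b = mat (a * b)" for a b
    by (simp add: matrix_matrix_mult_def mat_def vec_eq_iff mult_delta_left)
  let ?S = "mat c :: real^'n^'n" and ?S' = "mat (1 / c) :: real^'n^'n"
  have S: "?S ** ?S' = mat 1" "?S' ** ?S = mat 1"
    using assms by (simp_all add: *)
  have I: "?S ** matrix_inv ?S = mat 1 \<and> matrix_inv ?S ** ?S = mat 1"
    unfolding matrix_inv_def by (rule someI[where x = ?S']) (use S in blast)
  have "matrix_inv ?S = (?S' ** ?S) ** matrix_inv ?S"
    by (simp only: S matrix_mul_lid)
  also have "\<dots> = ?S' ** (?S ** matrix_inv ?S)"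
    by (simp only: matrix_mul_assoc)
  also have "\<dots> = ?S'"
    by (simp only: I matrix_mul_rid)
  finally show ?thesis .
qed

lemma ln_mvnormal_density_mat:
  fixes x m :: "real^2"
  assumes "c > 0"
  shows "mvnormal_density m (mat c) x > 0"
    and "ln (mvnormal_density m (mat c) x) = - ln (2 * pi) - ln c - (norm (x - m))\<^sup>2 / (2 * c)"
proof -
  have d: "det (mat c :: real^2^2) = c\<^sup>2"
    by (simp add: det_2 mat_def power2_eq_square)
  have v: "mat (1 / c) *v y = (1 / c) *\<^sub>R y" for y :: "real^2"
    by (simp add: vec_eq_iff matrix_vector_mult_def mat_def sum_2 forall_2)
  have "sqrt ((2 * pi) ^ CARD(2) * c\<^sup>2) = 2 * pi * c"
    using assms by (simp add: real_sqrt_mult)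
  then have e: "mvnormal_density m (mat c) x =
      exp (- ((norm (x - m))\<^sup>2 / (2 * c))) / (2 * pi * c)"
    using assms
    by (simp add: mvnormal_density_def d matrix_inv_mat v power2_norm_eq_inner)
  show "mvnormal_density m (mat c) x > 0"
    using assms by (simp add: e)
  show "ln (mvnormal_density m (mat c) x) = - ln (2 * pi) - ln c - (norm (x - m))\<^sup>2 / (2 * c)"
    using assms by (simp add: e ln_div ln_mult)
qed

lemma ln_likelihood:
  assumes "\<forall>j\<le>J. v j > 0"
  shows "ln (likelihood T J f g m n v) =
     - (real (T + 1) * real (1 + 2 * J) * ln (2 * pi))
     - (\<Sum>t=0..T. ln (v 0) + (\<Sum>j=1..J. 2 * ln (v j)))
     - 1 / 2 * (\<Sum>t=0..T. (norm (f t 0 - m 0))\<^sup>2 / v 0)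
     - 1 / 2 * (\<Sum>t=0..T. \<Sum>j=1..J.
         ((norm (f t j - m j))\<^sup>2 + (norm (g t j - n j))\<^sup>2) / v j)"
proof -
  define a where "a t j = mvnormal_density (m j) (mat (v j)) (f t j)" for t j
  define b where "b t j = mvnormal_density (n j) (mat (v j)) (g t j)" for t j
  define p where "p = (\<Sum>j=1..J. 2 * ln (v j))"
  define q where "q t j = ((norm (f t j - m j))\<^sup>2 + (norm (g t j - n j))\<^sup>2) / v j" for t j
  have a: "a t j > 0" "ln (a t j) = - ln (2 * pi) - ln (v j) - (norm (f t j - m j))\<^sup>2 / (2 * v j)"
    and b: "b t j > 0" "ln (b t j) = - ln (2 * pi) - ln (v j) - (norm (g t j - n j))\<^sup>2 / (2 * v j)"
    if "j \<le> J" for t j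
    using ln_mvnormal_density_mat[of "v j"] assms that by (auto simp: a_def b_def)
  have ab: "ln (a t j * b t j) = - 2 * ln (2 * pi) - 2 * ln (v j) - 1 / 2 * q t j" if "j \<le> J" for t j
  proof -
    have "ln (a t j * b t j) = ln (a t j) + ln (b t j)"
      by (rule ln_mult_pos[OF a(1)[OF that] b(1)[OF that]])
    then show ?thesis
      by (simp only: a(2)[OF that] b(2)[OF that] q_def) (simp add: add_divide_distrib)
  qed
  have P: "(\<Prod>j=1..J. a t j * b t j) > 0" for t
    by (intro prod_pos ballI mult_pos_pos a(1) b(1)) auto
  have L: "ln (\<Prod>j=1..J. a t j * b t j) =
      - 2 * real J * ln (2 * pi) - p - 1 / 2 * (\<Sum>j=1..J. q t j)" for t
  proof -
    have "ln (\<Prod>j=1..J. a t j * b t j) = (\<Sum>j=1..J. ln (a t j * b t j))"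
    proof (rule ln_prod)
      show "a t j * b t j \<noteq> 0" if "j \<in> {1..J}" for j
      proof -
        have "j \<le> J"
          using that by simp
        then have "a t j > 0" "b t j > 0"
          by (rule a(1), rule b(1))
        then show ?thesis
          by simp
      qed
    qed simp
    also have "\<dots> = (\<Sum>j=1..J. - 2 * ln (2 * pi) - 2 * ln (v j) - 1 / 2 * q t j)"
      by (intro sum.cong refl ab) auto
    also have "\<dots> = - 2 * real J * ln (2 * pi) - p - 1 / 2 * (\<Sum>j=1..J. q t j)"
      unfolding sum_subtractf p_def sum_distrib_left by simp
    finally show ?thesis .
  qed
  have K: "ln (a t 0 * (\<Prod>j=1..J. a t j * b t j)) = - (real (1 + 2 * J) * ln (2 * pi))
      - (ln (v 0) + p) - 1 / 2 * ((norm (f t 0 - m 0))\<^sup>2 / v 0) - 1 / 2 * (\<Sum>j=1..J. q t j)" for t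
  proof -
    have "ln (a t 0 * (\<Prod>j=1..J. a t j * b t j)) =
        ln (a t 0) + ln (\<Prod>j=1..J. a t j * b t j)"
      by (rule ln_mult_pos[OF a(1)[OF le0] P])
    then show ?thesis
      by (simp only: a(2)[OF le0] L) (simp add: distrib_right)
  qed
  have "ln (likelihood T J f g m n v) =
      (\<Sum>t=0..T. ln (a t 0 * (\<Prod>j=1..J. a t j * b t j)))"
    unfolding likelihood_def a_def[symmetric] b_def[symmetric]
    using mult_pos_pos[OF a(1)[OF le0] P] by (intro ln_prod finite_atLeastAtMost) (metis less_irrefl)
  also have "\<dots> = - (real (T + 1) * real (1 + 2 * J) * ln (2 * pi))
     - (\<Sum>t=0..T. ln (v 0) + p)
     - 1 / 2 * (\<Sum>t=0..T. (norm (f t 0 - m 0))\<^sup>2 / v 0)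
     - 1 / 2 * (\<Sum>t=0..T. \<Sum>j=1..J. q t j)"
    unfolding K sum_subtractf sum_distrib_left[symmetric] by simp
  finally show ?thesis
    unfolding p_def q_def .
qed

end

theory Submission
  imports Defs
begin

text \<open>
The random curves enter only through their Fourier coefficients, so the first task is to identify
these. Since \<open>\<Sum>j. j powr (2 + \<epsilon>) * (\<sigma> j)\<^sup>2\<close> converges, the coefficient sequences of the noise are almost
surely absolutely summable. A path of the noise is then the sum of a uniformly convergent
trigonometric series: at each rational angle this is the assumed almost sure convergence, and
countably many angles suffice because both sides are continuous. Orthogonality of the trigonometric
system gives \<open>F t j = \<mu> j + (A t j 1, A t j 2)\<close> and \<open>G t j = \<nu> j + (B t j 1, B t j 2)\<close> almost surely
(\<open>AE_fourier_coefficients_noise\<close>). Hence each order provides samples, independent of each other and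
of those of the other orders, of planar Gaussian vectors with covariance \<open>(\<sigma> j)\<^sup>2 I\<^sub>2\<close>.

The joint law of the sample mean \<open>m\<close> and the scatter (the sum of squared distances from \<open>m\<close>) follows by
induction on the sample size (\<open>gaussian_sample\<close>). A further observation \<open>Z\<close> moves the mean of \<open>n + 1\<close>
observations by \<open>(Z - m) / (n + 2)\<close> and increases the scatter by \<open>(n + 1) / (n + 2) * \<parallel>Z - m\<parallel>\<^sup>2\<close>. The
map from \<open>(m, Z)\<close> to the new mean and the increment \<open>Z - m\<close> is a composition of two shears, so it
preserves Lebesgue measure, and it turns the product of the two Gaussian densities into another such
product. So the new mean is independent of the increment as well as of the old scatter.
Working with planar vectors instead of their coordinates makes the squared norm of a centred Gaussian
increment exponentially distributed, because the area of a disc is proportional to its squared radius.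
The scatter is therefore a sum of independent exponential variables, that is, Erlang distributed, and
an Erlang law with rate 1/2 is a \<open>\<chi>\<^sup>2\<close> law with an even number of degrees of freedom. Only even
numbers, \<open>2 T\<close> and \<open>4 T\<close>, occur here.

Consistency is then explicit: the probability that the mean deviates by \<open>e\<close> is the tail of an
exponential law, and for the variances Markov's inequality is applied to the mean square deviation of
an Erlang variable.

For the maximum likelihood property (\<open>is_mle_iff\<close>) the logarithm of the likelihood is a constant minus
a sum of costs, one for each order with its own parameters. Each cost is uniquely minimal at the
estimators by \<open>ln x \<le> x - 1\<close>, with equality for \<open>x = 1\<close> only, provided that the scatter is positive.
That holds almost surely, because the scatter has a density on the positive half-line.
\<close>

section \<open>Trigonometric series and Fourier coefficients\<close>

lemma has_integral_cos_multiple: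
  "((\<lambda>x. cos (of_int k * x)) has_integral (if k = 0 then 2 * pi else 0)) {-pi..pi}"
proof (cases "k = 0")
  case True
  have "((\<lambda>x::real. 1::real) has_integral 2 * pi) {-pi..pi}"
    using has_integral_const_real[of "1::real" "-pi" pi] by simp
  with True show ?thesis by simp
next
  case False
  have "((\<lambda>x. cos (of_int k * x)) has_integral
      (sin (of_int k * pi) / of_int k - sin (of_int k * -pi) / of_int k)) {-pi..pi}"
    using False
    by (intro fundamental_theorem_of_calculus)
       (auto intro!: derivative_eq_intros simp flip: has_real_derivative_iff_has_vector_derivative)
  moreover have "sin (of_int k * pi) = 0"
    by (simp add: mult.commute sin_int_times_real)
  ultimately show ?thesis
    using False by simp
qed

lemma has_integral_sin_multiple:
  "((\<lambda>x. sin (of_int k * x)) has_integral 0) {-pi..pi}"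
proof (cases "k = 0")
  case False
  have "((\<lambda>x. sin (of_int k * x)) has_integral
      (- cos (of_int k * pi) / of_int k - - cos (of_int k * -pi) / of_int k)) {-pi..pi}"
    using False
    by (intro fundamental_theorem_of_calculus)
       (auto intro!: derivative_eq_intros simp flip: has_real_derivative_iff_has_vector_derivative)
  then show ?thesis by simp
qed simp

lemma has_integral_cos_cos:
  "((\<lambda>x. cos (real k * x) * cos (real j * x)) has_integral
     (if j = k then if k = 0 then 2 * pi else pi else 0)) {-pi..pi}"
proof -
  have "((\<lambda>x. (cos (of_int (int k - int j) * x) + cos (of_int (int k + int j) * x)) / 2)
      has_integral ((if int k - int j = 0 then 2 * pi else 0) +
        (if int k + int j = 0 then 2 * pi else 0)) / 2) {-pi..pi}"
    by (intro has_integral_divide has_integral_add has_integral_cos_multiple)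
  also have "(\<lambda>x. (cos (of_int (int k - int j) * x) + cos (of_int (int k + int j) * x)) / 2)
      = (\<lambda>x. cos (real k * x) * cos (real j * x))"
    by (simp add: fun_eq_iff cos_add cos_diff distrib_right left_diff_distrib)
  moreover have "int k + int j = 0 \<longleftrightarrow> k = 0 \<and> j = 0"
    by auto
  ultimately show ?thesis by (auto split: if_splits)
qed

lemma has_integral_sin_sin:
  assumes "k \<ge> 1"
  shows "((\<lambda>x. sin (real k * x) * sin (real j * x)) has_integral (if j = k then pi else 0)) {-pi..pi}"
proof -
  have "((\<lambda>x. (cos (of_int (int k - int j) * x) - cos (of_int (int k + int j) * x)) / 2)
      has_integral ((if int k - int j = 0 then 2 * pi else 0) -
        (if int k + int j = 0 then 2 * pi else 0)) / 2) {-pi..pi}"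
    by (intro has_integral_divide has_integral_diff has_integral_cos_multiple)
  also have "(\<lambda>x. (cos (of_int (int k - int j) * x) - cos (of_int (int k + int j) * x)) / 2)
      = (\<lambda>x. sin (real k * x) * sin (real j * x))"
    by (simp add: fun_eq_iff cos_add cos_diff distrib_right left_diff_distrib)
  finally show ?thesis using assms by (auto split: if_splits)
qed

lemma has_integral_sin_cos:
  "((\<lambda>x. sin (real k * x) * cos (real j * x)) has_integral 0) {-pi..pi}"
proof -
  have "((\<lambda>x. (sin (of_int (int k + int j) * x) + sin (of_int (int k - int j) * x)) / 2)
      has_integral (0 + 0) / 2) {-pi..pi}"
    by (intro has_integral_divide has_integral_add has_integral_sin_multiple)
  also have "(\<lambda>x. (sin (of_int (int k + int j) * x) + sin (of_int (int k - int j) * x)) / 2)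
      = (\<lambda>x. sin (real k * x) * cos (real j * x))"
    by (simp add: fun_eq_iff sin_add sin_diff distrib_right left_diff_distrib)
  finally show ?thesis by simp
qed

text \<open>
  For an orthogonal family all but one of the integrals \<open>I n\<close> vanish, so the
  interchange of sum and integral, which uniform convergence permits, leaves a single term.
\<close>

lemma has_integral_orthogonal_series:
  fixes w :: "real \<Rightarrow> real" and g :: "nat \<Rightarrow> real \<Rightarrow> real"
  assumes w: "continuous_on {-pi..pi} w" "\<And>x. \<bar>w x\<bar> \<le> 1"
    and g: "\<And>n. continuous_on {-pi..pi} (g n)" "\<And>n x. \<bar>g n x\<bar> \<le> c n" "summable c"
    and I: "\<And>n. ((\<lambda>x. w x * g n x) has_integral I n) {-pi..pi}"
    and k: "\<And>n. n \<noteq> k \<Longrightarrow> I n = 0"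
  shows "((\<lambda>x. w x * (\<Sum>n. g n x)) has_integral I k) {-pi..pi}"
proof -
  have le: "norm (w x * g n x) \<le> c n" for n x
    using mult_mono[OF w(2)[of x] g(2)[of n x]] by (simp add: abs_mult)
  have "uniform_limit {-pi..pi} (\<lambda>n x. \<Sum>i<n. w x * g i x) (\<lambda>x. \<Sum>i. w x * g i x) sequentially"
    by (rule Weierstrass_m_test[OF le g(3)])
  moreover have "continuous_on {-pi..pi} (\<lambda>x. \<Sum>i<n. w x * g i x)" for n
    by (intro continuous_intros w g)
  ultimately obtain I' J where
    I': "\<And>n. ((\<lambda>x. \<Sum>i<n. w x * g i x) has_integral I' n) {-pi..pi}"
    and J: "((\<lambda>x. \<Sum>i. w x * g i x) has_integral J) {-pi..pi}"
    and lim: "I' \<longlonglongrightarrow> J"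
    by (rule uniform_limit_integral) auto
  have I'_eq: "I' = (\<lambda>n. \<Sum>i<n. I i)"
    by (rule ext, rule has_integral_unique[OF I']) (intro has_integral_sum I finite_lessThan)
  have "I sums I k"
    using sums_single[of k I] k by (auto elim!: back_subst[of "\<lambda>f. f sums I k"])
  then have "I' \<longlonglongrightarrow> I k"
    by (simp add: sums_def I'_eq)
  then have "J = I k"
    using lim LIMSEQ_unique by blast
  moreover have "(\<Sum>i. w x * g i x) = w x * (\<Sum>i. g i x)" for x
    using g(2) by (intro suminf_mult summable_comparison_test'[OF g(3), of 0]) auto
  ultimately show ?thesis
    using J by simp
qed

lemma trig_series_integrals:
  fixes a b :: "nat \<Rightarrow> real"
  assumes ab: "summable (\<lambda>n. \<bar>a n\<bar>)" "summable (\<lambda>n. \<bar>b n\<bar>)"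
  defines "S \<equiv> \<lambda>x. \<Sum>n. a n * cos (real n * x) + b n * sin (real n * x)"
  shows "continuous_on {-pi..pi} S"
    and "((\<lambda>x. cos (real k * x) * S x) has_integral (if k = 0 then 2 * pi else pi) * a k) {-pi..pi}"
    and "k \<ge> 1 \<Longrightarrow> ((\<lambda>x. sin (real k * x) * S x) has_integral pi * b k) {-pi..pi}"
proof -
  let ?g = "\<lambda>n x. a n * cos (real n * x) + b n * sin (real n * x)"
  have le: "\<bar>?g n x\<bar> \<le> \<bar>a n\<bar> + \<bar>b n\<bar>" for n x
  proof -
    have "\<bar>?g n x\<bar> \<le> \<bar>a n\<bar> * \<bar>cos (real n * x)\<bar> + \<bar>b n\<bar> * \<bar>sin (real n * x)\<bar>"
      using abs_triangle_ineq[of "a n * cos (real n * x)" "b n * sin (real n * x)"]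
      by (simp add: abs_mult)
    also have "\<dots> \<le> \<bar>a n\<bar> * 1 + \<bar>b n\<bar> * 1"
      by (intro add_mono mult_left_mono) auto
    finally show ?thesis by simp
  qed
  have sm: "summable (\<lambda>n. \<bar>a n\<bar> + \<bar>b n\<bar>)"
    using ab by (rule summable_add)
  have cont: "continuous_on {-pi..pi} (?g n)" for n
    by (intro continuous_intros)
  show "continuous_on {-pi..pi} S"
    unfolding S_def
  proof (rule uniform_limit_theorem)
    show "uniform_limit {-pi..pi} (\<lambda>n x. \<Sum>i<n. ?g i x) (\<lambda>x. \<Sum>i. ?g i x) sequentially"
      by (rule Weierstrass_m_test[OF _ sm]) (use le in auto)
  qed (auto intro!: always_eventually continuous_intros)
  have "((\<lambda>x. cos (real k * x) * S x) has_integral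
      a k * (if k = k then if k = 0 then 2 * pi else pi else 0) + b k * 0) {-pi..pi}"
    unfolding S_def
  proof (rule has_integral_orthogonal_series[where
        I = "\<lambda>n. a n * (if n = k then if k = 0 then 2 * pi else pi else 0) + b n * 0" and k = k, OF _ _ cont le sm])
    fix n
    have "((\<lambda>x. a n * (cos (real k * x) * cos (real n * x)) + b n * (sin (real n * x) * cos (real k * x)))
        has_integral a n * (if n = k then if k = 0 then 2 * pi else pi else 0) + b n * 0) {-pi..pi}"
      by (intro has_integral_add has_integral_mult_right has_integral_cos_cos has_integral_sin_cos)
    then show "((\<lambda>x. cos (real k * x) * ?g n x) has_integral
        a n * (if n = k then if k = 0 then 2 * pi else pi else 0) + b n * 0) {-pi..pi}"
      by (simp add: algebra_simps)
  qed (auto intro!: continuous_intros)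
  then show "((\<lambda>x. cos (real k * x) * S x) has_integral (if k = 0 then 2 * pi else pi) * a k) {-pi..pi}"
    by (simp add: mult.commute split: if_splits)
  assume k: "k \<ge> 1"
  have "((\<lambda>x. sin (real k * x) * S x) has_integral
      a k * 0 + b k * (if k = k then pi else 0)) {-pi..pi}"
    unfolding S_def
  proof (rule has_integral_orthogonal_series[where
        I = "\<lambda>n. a n * 0 + b n * (if n = k then pi else 0)" and k = k, OF _ _ cont le sm])
    fix n
    have "((\<lambda>x. a n * (sin (real k * x) * cos (real n * x)) + b n * (sin (real k * x) * sin (real n * x)))
        has_integral a n * 0 + b n * (if n = k then pi else 0)) {-pi..pi}"
      by (intro has_integral_add has_integral_mult_right has_integral_sin_sin[OF k] has_integral_sin_cos)
    then show "((\<lambda>x. sin (real k * x) * ?g n x) has_integral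
        a n * 0 + b n * (if n = k then pi else 0)) {-pi..pi}"
      by (simp add: algebra_simps)
  qed (auto intro!: continuous_intros)
  then show "((\<lambda>x. sin (real k * x) * S x) has_integral pi * b k) {-pi..pi}"
    by (simp add: mult.commute)
qed

text \<open>
  Convergence is required at rational points only, because for random series an almost sure
  statement is available at countably many points simultaneously. Continuity of \<open>f\<close>
  and of the sum of the series extends the equality to the whole interval.
\<close>

lemma fourier_coefficients_trig_series:
  fixes f :: "real \<Rightarrow> real^2" and a b :: "nat \<Rightarrow> 2 \<Rightarrow> real"
  assumes f: "continuous_on {-pi..pi} f"
    and ab: "\<And>i. summable (\<lambda>n. \<bar>a n i\<bar>)" "\<And>i. summable (\<lambda>n. \<bar>b n i\<bar>)"
    and sums: "\<And>x i. x \<in> {-pi..pi} \<inter> \<rat> \<Longrightarrow>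
      (\<lambda>n. a n i * cos (real n * x) + b n i * sin (real n * x)) sums (f x $ i)"
  shows "fourier_cos f k = (\<chi> i. a k i)"
    and "k \<ge> 1 \<Longrightarrow> fourier_sin f k = (\<chi> i. b k i)"
proof -
  define S where "S i x = (\<Sum>n. a n i * cos (real n * x) + b n i * sin (real n * x))" for i x
  have "{-pi..pi} \<subseteq> closure ({-pi..pi} \<inter> \<rat>)"
  proof -
    have "{-pi<..<pi} \<subseteq> closure ({-pi<..<pi} \<inter> \<rat>)"
      using open_Int_closure_subset[of "{-pi<..<pi}" "\<rat>"] by (simp add: Rats_closure_real)
    then have "closure {-pi<..<pi} \<subseteq> closure ({-pi<..<pi} \<inter> \<rat>)"
      by (rule closure_minimal) simp
    also have "\<dots> \<subseteq> closure ({-pi..pi} \<inter> \<rat>)"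
      by (intro closure_mono) auto
    finally show ?thesis
      using closure_greaterThanLessThan[of "-pi" pi] pi_gt_zero by simp
  qed
  moreover have "closure ({-pi..pi} \<inter> \<rat>) \<subseteq> {-pi..pi}"
    by (intro closure_minimal) auto
  ultimately have cl: "closure ({-pi..pi} \<inter> \<rat>) = {-pi..pi}" by (rule antisym[rotated])
  have eq: "f x $ i = S i x" if x: "x \<in> {-pi..pi}" for x i
  proof -
    have "f x $ i - S i x = 0"
    proof (rule continuous_constant_on_closure[of "{-pi..pi} \<inter> \<rat>" "\<lambda>x. f x $ i - S i x"])
      show "continuous_on (closure ({-pi..pi} \<inter> \<rat>)) (\<lambda>x. f x $ i - S i x)"
        unfolding cl S_def
        by (intro continuous_intros f trig_series_integrals(1) ab)
      show "x \<in> closure ({-pi..pi} \<inter> \<rat>)" using x cl by simp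
      show "f y $ i - S i y = 0" if "y \<in> {-pi..pi} \<inter> \<rat>" for y
        using sums_unique[OF sums[OF that, of i]] by (simp add: S_def)
    qed
    then show ?thesis by simp
  qed
  have int: "(\<lambda>x. w x *\<^sub>R f x) integrable_on {-pi..pi}" if "continuous_on {-pi..pi} w" for w
    by (intro integrable_continuous_interval continuous_intros f that)
  have comp: "integral {-pi..pi} (\<lambda>x. w x *\<^sub>R f x) $ i = I"
    if "continuous_on {-pi..pi} w" and I: "((\<lambda>x. w x * S i x) has_integral I) {-pi..pi}" for w I i
  proof -
    have "integral {-pi..pi} (\<lambda>x. w x *\<^sub>R f x) $ i = integral {-pi..pi} (\<lambda>x. (w x *\<^sub>R f x) $ i)"
      by (rule integral_component_eq_cart[symmetric, OF int]) fact
    also have "\<dots> = integral {-pi..pi} (\<lambda>x. w x * S i x)"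
      by (intro Henstock_Kurzweil_Integration.integral_cong) (simp add: eq)
    finally show ?thesis using I by (simp add: integral_unique)
  qed
  show "fourier_cos f k = (\<chi> i. a k i)"
  proof -
    have "integral {-pi..pi} (\<lambda>x. cos (real k * x) *\<^sub>R f x) $ i = (if k = 0 then 2 * pi else pi) * a k i" for i
      unfolding S_def
      by (rule comp[unfolded S_def, OF _ trig_series_integrals(2)[OF ab]])
         (intro continuous_intros)
    then show ?thesis by (simp add: fourier_cos_def vec_eq_iff)
  qed
  assume "k \<ge> 1"
  have "integral {-pi..pi} (\<lambda>x. sin (real k * x) *\<^sub>R f x) $ i = pi * b k i" for i
    by (rule comp[unfolded S_def, OF _ trig_series_integrals(3)[OF ab \<open>k \<ge> 1\<close>]])
       (intro continuous_intros)
  then show "fourier_sin f k = (\<chi> i. b k i)"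
    by (simp add: fourier_sin_def vec_eq_iff)
qed

lemma C1_within_imp_continuous_on: "C1_within f S \<Longrightarrow> continuous_on S f"
  by (auto simp: C1_within_def continuous_on_eq_continuous_within
      intro: has_vector_derivative_continuous)

lemma fourier_coefficients_add:
  assumes "continuous_on {-pi..pi} f" "continuous_on {-pi..pi} g"
  shows "fourier_cos (\<lambda>\<theta>. f \<theta> + g \<theta>) j = fourier_cos f j + fourier_cos g j"
    and "fourier_sin (\<lambda>\<theta>. f \<theta> + g \<theta>) j = fourier_sin f j + fourier_sin g j"
proof -
  have trig: "continuous_on {-pi..pi} (\<lambda>\<theta>. cos (real j * \<theta>))" "continuous_on {-pi..pi} (\<lambda>\<theta>. sin (real j * \<theta>))"
    by (intro continuous_intros)+
  have "integral {-pi..pi} (\<lambda>\<theta>. w \<theta> *\<^sub>R (f \<theta> + g \<theta>))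
      = integral {-pi..pi} (\<lambda>\<theta>. w \<theta> *\<^sub>R f \<theta>) + integral {-pi..pi} (\<lambda>\<theta>. w \<theta> *\<^sub>R g \<theta>)"
    if "continuous_on {-pi..pi} w" for w
    unfolding scaleR_add_right
    by (intro Henstock_Kurzweil_Integration.integral_add integrable_continuous_interval
        continuous_on_scaleR that assms)
  from this[OF trig(1)] this[OF trig(2)]
  show "fourier_cos (\<lambda>\<theta>. f \<theta> + g \<theta>) j = fourier_cos f j + fourier_cos g j"
    and "fourier_sin (\<lambda>\<theta>. f \<theta> + g \<theta>) j = fourier_sin f j + fourier_sin g j"
    by (simp_all only: fourier_cos_def fourier_sin_def scaleR_add_right)
qed

section \<open>Gaussian vectors in the plane\<close>

lemma mvnormal_density_mat:
  fixes x m :: "real^2"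
  assumes "c > 0"
  shows "mvnormal_density m (mat c) x = exp (- (norm (x - m))\<^sup>2 / (2 * c)) / (2 * pi * c)"
proof -
  have "ln (mvnormal_density m (mat c) x) = - (norm (x - m))\<^sup>2 / (2 * c) - ln (2 * pi * c)"
    using assms by (simp add: ln_mvnormal_density_mat(2) ln_mult)
  then have "exp (ln (mvnormal_density m (mat c) x)) = exp (- (norm (x - m))\<^sup>2 / (2 * c)) / (2 * pi * c)"
    using assms by (simp add: exp_diff)
  then show ?thesis
    using ln_mvnormal_density_mat(1)[OF assms] by simp
qed

lemma distributed_borel_measurable_lborel:
  "distributed M lborel X f \<Longrightarrow> X \<in> borel_measurable M"
  using distributed_measurable[of M lborel X f] by simp

lemma borel_measurable_mvnormal_density [measurable]:
  fixes m :: "real^'n"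
  shows "mvnormal_density m S \<in> borel_measurable borel"
  unfolding mvnormal_density_def[abs_def]
proof -
  have [measurable]: "(*v) A \<in> borel_measurable borel" for A :: "real^'n^'n"
    by (intro borel_measurable_continuous_onI linear_continuous_on matrix_vector_mul_bounded_linear)
  show "(\<lambda>x. exp (- ((x - m) \<bullet> (matrix_inv S *v (x - m))) / 2) / sqrt ((2 * pi) ^ CARD('n) * det S))
      \<in> borel_measurable borel"
    by (intro borel_measurable_divide borel_measurable_const borel_measurable_exp
        measurable_compose[OF _ borel_measurable_exp] borel_measurable_uminus borel_measurable_inner
        borel_measurable_diff measurable_ident measurable_compose[of "\<lambda>x. x - m" borel borel "(*v) (matrix_inv S)"]) simp_all
qed

lemma measurable_vec2 [measurable]:
  assumes [measurable]: "f \<in> borel_measurable M" "g \<in> borel_measurable M"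
  shows "(\<lambda>x. vector [f x, g x] :: real^2) \<in> borel_measurable M"
proof -
  have "(\<lambda>x. vector [f x, g x] :: real^2) = (\<lambda>x. f x *\<^sub>R axis 1 1 + g x *\<^sub>R axis 2 1)"
    by (simp add: fun_eq_iff vec_eq_iff forall_2 axis_def)
  then show ?thesis by simp
qed

text \<open>
  The coordinates of the plane carry product Lebesgue measure; this turns pairs of independent
  real variables into plane vectors with a density.
\<close>

lemma lborel_real2:
  "distr (lborel \<Otimes>\<^sub>M lborel) borel (\<lambda>(x, y). vector [x, y]) = (lborel :: (real^2) measure)"
proof (rule lborel_eqI[symmetric])
  fix l u :: "real^2"
  assume le: "\<And>b. b \<in> Basis \<Longrightarrow> l \<bullet> b \<le> u \<bullet> b"
  have lu: "l $ i \<le> u $ i" for i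
  proof -
    have "axis i 1 \<in> (Basis :: (real^2) set)"
      by (rule axis_in_Basis_iff[THEN iffD2]) simp
    from le[OF this] show ?thesis by (simp add: inner_axis)
  qed
  have B: "(Basis :: (real^2) set) = {axis 1 1, axis 2 1}"
    by (auto simp: Basis_vec_def UNIV_2)
  have box_eq: "box l u = {x. l $ 1 < x $ 1 \<and> x $ 1 < u $ 1 \<and> l $ 2 < x $ 2 \<and> x $ 2 < u $ 2}"
    unfolding box_def B by (auto simp: inner_axis)
  have "(\<lambda>(x, y). vector [x, y] :: real^2) -` box l u \<inter> space (lborel \<Otimes>\<^sub>M lborel)
      = {l $ 1 <..< u $ 1} \<times> {l $ 2 <..< u $ 2}"
    unfolding box_eq by (auto simp: space_pair_measure)
  then have "emeasure (distr (lborel \<Otimes>\<^sub>M lborel) borel (\<lambda>(x, y). vector [x, y] :: real^2)) (box l u)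
      = emeasure (lborel \<Otimes>\<^sub>M lborel) ({l $ 1 <..< u $ 1} \<times> {l $ 2 <..< u $ 2})"
    by (subst emeasure_distr) (simp_all add: split_beta')
  also have "\<dots> = ennreal (u $ 1 - l $ 1) * ennreal (u $ 2 - l $ 2)"
    by (simp add: lborel.emeasure_pair_measure_Times lu)
  also have "\<dots> = ennreal ((u $ 1 - l $ 1) * (u $ 2 - l $ 2))"
    by (rule ennreal_mult[symmetric]) (simp_all add: lu)
  also have "(u $ 1 - l $ 1) * (u $ 2 - l $ 2) = (\<Prod>b\<in>Basis. (u - l) \<bullet> b)"
    unfolding B by (simp add: axis_eq_axis inner_axis)
  finally show "emeasure (distr (lborel \<Otimes>\<^sub>M lborel) borel (\<lambda>(x, y). vector [x, y] :: real^2)) (box l u)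
      = (\<Prod>b\<in>Basis. (u - l) \<bullet> b)" .
qed simp

lemma distr_normal_pair:
  assumes s: "s > 0"
  shows "distr (density lborel (normal_density 0 s) \<Otimes>\<^sub>M density lborel (normal_density 0 s)) borel
      (\<lambda>(x, y). vector [x, y]) = density lborel (mvnormal_density (0 :: real^2) (mat (s\<^sup>2)))"
proof -
  let ?n = "\<lambda>x. ennreal (normal_density 0 s x)" and ?v = "\<lambda>(x, y). vector [x, y] :: real^2"
  have eq: "?n x * ?n y = mvnormal_density 0 (mat (s\<^sup>2)) (?v (x, y))" for x y
  proof -
    have "(norm (vector [x, y] :: real^2))\<^sup>2 = x\<^sup>2 + y\<^sup>2"
      by (simp add: norm_vec_def L2_set_def sum_2)
    then have "normal_density 0 s x * normal_density 0 s y = mvnormal_density 0 (mat (s\<^sup>2)) (?v (x, y))"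
      using s by (simp add: mvnormal_density_mat normal_density_def exp_add[symmetric] field_simps
          real_sqrt_mult power2_eq_square)
    then show ?thesis by (simp flip: ennreal_mult)
  qed
  interpret prob_space "density lborel ?n"
    by (rule prob_space_normal_density[OF s])
  have "distr (density lborel ?n \<Otimes>\<^sub>M density lborel ?n) borel ?v
      = distr (density (lborel \<Otimes>\<^sub>M lborel) (\<lambda>(x, y). ?n x * ?n y)) borel ?v"
    by (subst pair_measure_density) (auto intro: lborel.sigma_finite_measure_axioms sigma_finite_measure_axioms)
  also have "(\<lambda>(x, y). ?n x * ?n y) = (\<lambda>z. ennreal (mvnormal_density 0 (mat (s\<^sup>2)) (?v z)))"
    by (auto simp: fun_eq_iff eq)
  also have "distr (density (lborel \<Otimes>\<^sub>M lborel) \<dots>) borel ?v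
      = density (distr (lborel \<Otimes>\<^sub>M lborel) borel ?v) (mvnormal_density 0 (mat (s\<^sup>2)))"
    by (subst density_distr) (auto simp: split_beta')
  finally show ?thesis
    by (simp add: lborel_real2)
qed

lemma prob_space_mvnormal_density:
  assumes "c > 0"
  shows "prob_space (density lborel (mvnormal_density (0 :: real^2) (mat c)))"
proof -
  have s: "sqrt c > 0" "(sqrt c)\<^sup>2 = c" using assms by auto
  let ?N = "density lborel (normal_density 0 (sqrt c))"
  interpret N: prob_space ?N
    by (rule prob_space_normal_density[OF s(1)])
  interpret P: pair_prob_space ?N ?N ..
  have "prob_space (distr (?N \<Otimes>\<^sub>M ?N) borel (\<lambda>(x, y). vector [x, y] :: real^2))"
    by (rule P.prob_space_distr) (simp add: split_beta')
  then show ?thesis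
    unfolding distr_normal_pair[OF s(1)] s(2) .
qed

lemma (in prob_space) distributed_vec2_normal:
  assumes "s > 0" "indep_var borel X borel Y"
    and X: "distributed M lborel X (normal_density 0 s)"
    and Y: "distributed M lborel Y (normal_density 0 s)"
  shows "distributed M lborel (\<lambda>\<omega>. vector [X \<omega>, Y \<omega>] :: real^2) (mvnormal_density 0 (mat (s\<^sup>2)))"
proof -
  note [measurable] = distributed_borel_measurable_lborel[OF X] distributed_borel_measurable_lborel[OF Y]
  let ?N = "density lborel (normal_density 0 s)"
  have *: "distr M borel X = ?N" "distr M borel Y = ?N"
    using X Y by (auto simp: distributed_def cong: distr_cong)
  have "distr M borel (\<lambda>\<omega>. vector [X \<omega>, Y \<omega>] :: real^2)
      = distr (distr M (borel \<Otimes>\<^sub>M borel) (\<lambda>\<omega>. (X \<omega>, Y \<omega>))) borel (\<lambda>(x, y). vector [x, y])"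
    by (subst distr_distr) (auto simp: comp_def split_beta')
  also have "distr M (borel \<Otimes>\<^sub>M borel) (\<lambda>\<omega>. (X \<omega>, Y \<omega>)) = ?N \<Otimes>\<^sub>M ?N"
    using assms(2) by (simp add: indep_var_distribution_eq *)
  finally show ?thesis
    by (simp add: distributed_def distr_normal_pair[OF assms(1)] cong: distr_cong)
qed

lemma distributed_mvnormal_translate:
  fixes X :: "'a \<Rightarrow> real^2"
  assumes X: "distributed M lborel X (mvnormal_density m\<^sub>0 (mat c))" and c: "c > 0"
  shows "distributed M lborel (\<lambda>\<omega>. m + X \<omega>) (mvnormal_density (m + m\<^sub>0) (mat c))"
proof -
  note [measurable] = distributed_borel_measurable_lborel[OF X]
  have "distr M borel (\<lambda>\<omega>. m + X \<omega>) = distr (distr M lborel X) borel ((+) m)"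
    by (subst distr_distr) (auto simp: comp_def)
  also have "\<dots> = distr (density lborel (\<lambda>x. ennreal (mvnormal_density (m + m\<^sub>0) (mat c) (m + x)))) borel ((+) m)"
    using X c by (simp add: distributed_def mvnormal_density_mat)
  also have "\<dots> = density (distr lborel borel ((+) m)) (mvnormal_density (m + m\<^sub>0) (mat c))"
    by (rule density_distr[symmetric]) auto
  finally show ?thesis
    by (simp add: distributed_def lborel_distr_plus cong: distr_cong)
qed

text \<open>
  The disc of squared radius \<open>a\<close> has area \<open>pi * a\<close>: the squared norm
  pushes planar Lebesgue measure forward to \<open>pi\<close> times Lebesgue measure on the
  positive half-line.
\<close>

lemma distr_lborel_norm_square:
  "distr lborel borel (\<lambda>x :: real^2. (norm x)\<^sup>2) = density lborel (\<lambda>s. ennreal (if s < 0 then 0 else pi))"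
proof (rule measure_eqI_generator_eq[of "range (\<lambda>a::real. {..a})" UNIV _ _ "\<lambda>i. {..real i}"])
  show "Int_stable (range (\<lambda>a::real. {..a}))"
    by (auto simp: Int_stable_def)
  fix A assume "A \<in> range (\<lambda>a::real. {..a})"
  then obtain a where A: "A = {..a}" by auto
  have eq: "(\<lambda>x :: real^2. (norm x)\<^sup>2) -` A = (if a < 0 then {} else cball 0 (sqrt a))"
    by (auto simp: A real_le_rsqrt sqrt_ge_absD dest: order_trans[OF zero_le_power2])
  have "emeasure (distr lborel borel (\<lambda>x :: real^2. (norm x)\<^sup>2)) A = (if a < 0 then 0 else ennreal (pi * a))"
    by (subst emeasure_distr) (auto simp: A eq[unfolded A] emeasure_cball unit_ball_vol_2)
  also have "\<dots> = (\<integral>\<^sup>+s. ennreal pi * indicator {0..a} s \<partial>lborel)"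
    by (simp add: nn_integral_cmult_indicator ennreal_mult)
  also have "\<dots> = emeasure (density lborel (\<lambda>s. ennreal (if s < 0 then 0 else pi))) A"
    by (subst emeasure_density) (auto simp: A indicator_def intro!: nn_integral_cong)
  finally show "emeasure (distr lborel borel (\<lambda>x :: real^2. (norm x)\<^sup>2)) A
      = emeasure (density lborel (\<lambda>s. ennreal (if s < 0 then 0 else pi))) A" .
next
  have eq: "(\<lambda>x :: real^2. (norm x)\<^sup>2) -` {..a} \<subseteq> cball 0 (sqrt a)" for a
    by (auto intro: real_le_rsqrt)
  fix i
  have "emeasure (distr lborel borel (\<lambda>x :: real^2. (norm x)\<^sup>2)) {..real i} \<le> emeasure lborel (cball (0::real^2) (sqrt (real i)))"
    by (subst emeasure_distr) (auto intro!: emeasure_mono real_le_rsqrt)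
  also have "\<dots> < \<infinity>" by (simp add: emeasure_cball)
  finally show "emeasure (distr lborel borel (\<lambda>x :: real^2. (norm x)\<^sup>2)) {..real i} \<noteq> \<infinity>"
    by simp
qed (auto simp: borel_eq_atMost[where 'a=real] real_arch_simple)

text \<open>
  The Gaussian density depends on \<open>x\<close> through \<open>(norm x)\<^sup>2\<close> only,
  so pushing it forward along the squared norm multiplies it by the constant \<open>pi\<close> and
  leaves an exponential density.
\<close>

lemma (in prob_space) mvnormal_norm_square:
  fixes X :: "'a \<Rightarrow> real^2"
  assumes X: "distributed M lborel X (mvnormal_density 0 (mat c))" and c: "c > 0"
  shows "distributed M lborel (\<lambda>\<omega>. (norm (X \<omega>))\<^sup>2 / c) (exponential_density (1 / 2))"
proof -
  note [measurable] = distributed_borel_measurable_lborel[OF X]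
  let ?q = "\<lambda>x :: real^2. (norm x)\<^sup>2"
  let ?g = "\<lambda>s. ennreal (exp (- s / (2 * c)) / (2 * pi * c))"
  have "distr M lborel (\<lambda>\<omega>. ?q (X \<omega>)) = distr (distr M lborel X) borel ?q"
    by (subst distr_distr) (auto simp: comp_def cong: distr_cong)
  also have "\<dots> = distr (density lborel (\<lambda>x. ?g (?q x))) borel ?q"
    using X c by (simp add: distributed_def mvnormal_density_mat)
  also have "\<dots> = density (distr lborel borel ?q) ?g"
    by (rule density_distr[symmetric]) auto
  also have "\<dots> = density lborel (exponential_density (1 / (2 * c)))"
    unfolding distr_lborel_norm_square
    using c by (subst density_density_eq)
      (auto simp: ennreal_mult[symmetric] erlang_density_def intro!: density_cong)
  finally have "distributed M lborel (\<lambda>\<omega>. ?q (X \<omega>)) (exponential_density (1 / (2 * c)))"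
    by (auto simp: distributed_def)
  from erlang_distributed_mult_const[OF this, of "1 / c"] c show ?thesis
    by simp
qed

section \<open>Independence of variables with different value spaces\<close>

lemma (in prob_space) distr_pair_snd:
  assumes "prob_space N" shows "distr (N \<Otimes>\<^sub>M M) M snd = M"
proof (rule measure_eqI)
  interpret N: prob_space N by fact
  fix A assume "A \<in> sets (distr (N \<Otimes>\<^sub>M M) M snd)"
  then have A: "A \<in> sets M" by simp
  then have "emeasure (distr (N \<Otimes>\<^sub>M M) M snd) A = emeasure (N \<Otimes>\<^sub>M M) (space N \<times> A)"
    by (auto simp add: emeasure_distr space_pair_measure dest: sets.sets_into_space intro!: arg_cong2[where f=emeasure])
  with A show "emeasure (distr (N \<Otimes>\<^sub>M M) M snd) A = emeasure M A"
    by (simp add: emeasure_pair_measure_Times N.emeasure_space_1)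
qed simp

text \<open>
  The library predicate \<open>indep_var\<close> requires both variables to take values in one
  type. Here a vector has to be independent of a real number or of a pair, hence the formulation
  by product laws, which agrees with \<open>indep_var\<close> when both apply
  (\<open>indep_pair_iff_indep_var\<close>).
\<close>

definition (in prob_space) indep_pair ::
    "'b measure \<Rightarrow> ('a \<Rightarrow> 'b) \<Rightarrow> 'c measure \<Rightarrow> ('a \<Rightarrow> 'c) \<Rightarrow> bool" where
  "indep_pair S X T Y \<longleftrightarrow> X \<in> measurable M S \<and> Y \<in> measurable M T \<and>
     distr M (S \<Otimes>\<^sub>M T) (\<lambda>\<omega>. (X \<omega>, Y \<omega>)) = distr M S X \<Otimes>\<^sub>M distr M T Y"

lemma (in prob_space) indep_pair_measurable:
  assumes "indep_pair S X T Y"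
  shows "X \<in> measurable M S" "Y \<in> measurable M T"
  using assms by (auto simp: indep_pair_def)

lemma (in prob_space) indep_pair_iff_indep_var:
  "indep_pair S X T Y \<longleftrightarrow> indep_var S X T Y"
  by (auto simp: indep_pair_def indep_var_distribution_eq)

text \<open>
  A factorisation of the joint law into any two probability measures suffices, as the factors are
  then the marginals. This is how independence is read off from a joint density.
\<close>

lemma (in prob_space) indep_pair_if_product_law:
  assumes [measurable]: "X \<in> measurable M S" "Y \<in> measurable M T"
    and law: "distr M (S \<Otimes>\<^sub>M T) (\<lambda>\<omega>. (X \<omega>, Y \<omega>)) = P \<Otimes>\<^sub>M Q"
    and PQ: "prob_space P" "prob_space Q" "sets P = sets S" "sets Q = sets T"
  shows "indep_pair S X T Y" "distr M S X = P" "distr M T Y = Q"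
proof -
  interpret P: prob_space P by fact
  interpret Q: prob_space Q by fact
  have "distr M S X = distr (distr M (S \<Otimes>\<^sub>M T) (\<lambda>\<omega>. (X \<omega>, Y \<omega>))) S fst"
    by (subst distr_distr) (auto simp: comp_def)
  also have "\<dots> = distr (P \<Otimes>\<^sub>M Q) P fst"
    unfolding law by (rule distr_cong) (simp_all add: PQ)
  finally show 1: "distr M S X = P"
    by (simp add: Q.distr_pair_fst)
  have "distr M T Y = distr (distr M (S \<Otimes>\<^sub>M T) (\<lambda>\<omega>. (X \<omega>, Y \<omega>))) T snd"
    by (subst distr_distr) (auto simp: comp_def)
  also have "\<dots> = distr (P \<Otimes>\<^sub>M Q) Q snd"
    unfolding law by (rule distr_cong) (simp_all add: PQ)
  finally show 2: "distr M T Y = Q"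
    by (simp add: Q.distr_pair_snd PQ)
  show "indep_pair S X T Y"
    by (simp add: indep_pair_def 1 2 law)
qed

lemma (in prob_space) indep_pair_compose:
  assumes XY: "indep_pair S X T Y" and [measurable]: "f \<in> measurable S S'" "g \<in> measurable T T'"
  shows "indep_pair S' (\<lambda>\<omega>. f (X \<omega>)) T' (\<lambda>\<omega>. g (Y \<omega>))"
proof -
  note [measurable] = indep_pair_measurable[OF XY]
  have fX: "distr (distr M S X) S' f = distr M S' (\<lambda>\<omega>. f (X \<omega>))"
    and gY: "distr (distr M T Y) T' g = distr M T' (\<lambda>\<omega>. g (Y \<omega>))"
    by (simp_all add: distr_distr comp_def)
  have "distr M (S' \<Otimes>\<^sub>M T') (\<lambda>\<omega>. (f (X \<omega>), g (Y \<omega>)))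
      = distr (distr M (S \<Otimes>\<^sub>M T) (\<lambda>\<omega>. (X \<omega>, Y \<omega>))) (S' \<Otimes>\<^sub>M T') (\<lambda>(x, y). (f x, g y))"
    by (subst distr_distr) (auto simp: comp_def split_beta')
  also have "\<dots> = distr (distr M S X \<Otimes>\<^sub>M distr M T Y) (S' \<Otimes>\<^sub>M T') (\<lambda>(x, y). (f x, g y))"
    using XY by (simp add: indep_pair_def)
  also have "\<dots> = distr (distr M S X) S' f \<Otimes>\<^sub>M distr (distr M T Y) T' g"
  proof (rule pair_measure_distr[symmetric])
    have "prob_space (distr (distr M T Y) T' g)"
      unfolding gY by (rule prob_space_distr) simp
    then show "sigma_finite_measure (distr (distr M T Y) T' g)"
      by (simp add: prob_space_def finite_measure.axioms(1))
  qed simp_all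
  finally show ?thesis
    by (simp add: indep_pair_def fX gY)
qed

lemma (in prob_space) indep_pair_sym:
  assumes XY: "indep_pair S X T Y"
  shows "indep_pair T Y S X"
proof -
  note [measurable] = indep_pair_measurable[OF XY]
  let ?P = "distr M S X" and ?Q = "distr M T Y"
  interpret P: prob_space ?P by (rule prob_space_distr) simp
  interpret Q: prob_space ?Q by (rule prob_space_distr) simp
  interpret QP: pair_prob_space ?Q ?P ..
  have "distr M (T \<Otimes>\<^sub>M S) (\<lambda>\<omega>. (Y \<omega>, X \<omega>))
      = distr (distr M (S \<Otimes>\<^sub>M T) (\<lambda>\<omega>. (X \<omega>, Y \<omega>))) (T \<Otimes>\<^sub>M S) (\<lambda>(x, y). (y, x))"
    by (subst distr_distr) (auto simp: comp_def split_beta')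
  also have "\<dots> = distr (?P \<Otimes>\<^sub>M ?Q) (?Q \<Otimes>\<^sub>M ?P) (\<lambda>(x, y). (y, x))"
    using XY by (intro distr_cong sets_pair_measure_cong) (simp_all add: indep_pair_def)
  also have "\<dots> = ?Q \<Otimes>\<^sub>M ?P"
    by (rule QP.distr_pair_swap[symmetric])
  finally show ?thesis
    by (simp add: indep_pair_def)
qed

text \<open>
  For a fixed value of \<open>Z\<close>, the event that \<open>(X, Z)\<close> is in
  \<open>A\<close> and \<open>Y\<close> is in \<open>B\<close> is a rectangle in the values of
  \<open>(X, Y)\<close>, with a side \<open>B\<close> that does not depend on \<open>Z\<close>.
  Integration over the law of \<open>Z\<close> therefore keeps the factor of \<open>Y\<close>
  apart.
\<close>

lemma (in prob_space) indep_pair_swap: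
  assumes XY: "indep_pair S X T Y" and XYZ: "indep_pair (S \<Otimes>\<^sub>M T) (\<lambda>\<omega>. (X \<omega>, Y \<omega>)) U Z"
  shows "indep_pair (S \<Otimes>\<^sub>M U) (\<lambda>\<omega>. (X \<omega>, Z \<omega>)) T Y"
proof -
  note [measurable] = indep_pair_measurable[OF XY] indep_pair_measurable(2)[OF XYZ]
  let ?P = "distr M S X" and ?Q = "distr M T Y" and ?R = "distr M U Z"
  interpret P: prob_space ?P by (rule prob_space_distr) simp
  interpret Q: prob_space ?Q by (rule prob_space_distr) simp
  interpret R: prob_space ?R by (rule prob_space_distr) simp
  interpret PQ: pair_prob_space ?P ?Q ..
  interpret PR: pair_prob_space ?P ?R ..
  interpret PQR: pair_prob_space "?P \<Otimes>\<^sub>M ?Q" ?R ..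
  have PRlaw: "distr M (S \<Otimes>\<^sub>M U) (\<lambda>\<omega>. (X \<omega>, Z \<omega>)) = ?P \<Otimes>\<^sub>M ?R"
    using indep_pair_compose[OF XYZ, of fst S "\<lambda>z. z" U] by (simp add: indep_pair_def)
  have PQRlaw: "distr M ((S \<Otimes>\<^sub>M T) \<Otimes>\<^sub>M U) (\<lambda>\<omega>. ((X \<omega>, Y \<omega>), Z \<omega>)) = (?P \<Otimes>\<^sub>M ?Q) \<Otimes>\<^sub>M ?R"
    using XY XYZ by (simp add: indep_pair_def)
  have eq: "(?P \<Otimes>\<^sub>M ?R) \<Otimes>\<^sub>M ?Q = distr M ((S \<Otimes>\<^sub>M U) \<Otimes>\<^sub>M T) (\<lambda>\<omega>. ((X \<omega>, Z \<omega>), Y \<omega>))"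
  proof (rule pair_measure_eqI)
    show "sigma_finite_measure (?P \<Otimes>\<^sub>M ?R)" "sigma_finite_measure ?Q"
      by unfold_locales
    fix A B assume A[measurable]: "A \<in> sets (?P \<Otimes>\<^sub>M ?R)" and B[measurable]: "B \<in> sets ?Q"
    have AB[measurable]: "{((x, y), z) | x y z. (x, z) \<in> A \<and> y \<in> B} \<in> sets ((S \<Otimes>\<^sub>M T) \<Otimes>\<^sub>M U)" (is "?AB \<in> _")
    proof -
      have "?AB = (\<lambda>((x, y), z). ((x, z), y)) -` (A \<times> B) \<inter> space ((S \<Otimes>\<^sub>M T) \<Otimes>\<^sub>M U)"
        using sets.sets_into_space[OF A] sets.sets_into_space[OF B]
        by (auto simp: space_pair_measure)
      also have "\<dots> \<in> sets ((S \<Otimes>\<^sub>M T) \<Otimes>\<^sub>M U)"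
        using A B by (intro measurable_sets[where A = "(S \<Otimes>\<^sub>M U) \<Otimes>\<^sub>M T"]) (auto simp: split_beta')
      finally show ?thesis .
    qed
    have "emeasure (distr M ((S \<Otimes>\<^sub>M U) \<Otimes>\<^sub>M T) (\<lambda>\<omega>. ((X \<omega>, Z \<omega>), Y \<omega>))) (A \<times> B)
        = emeasure (distr M ((S \<Otimes>\<^sub>M T) \<Otimes>\<^sub>M U) (\<lambda>\<omega>. ((X \<omega>, Y \<omega>), Z \<omega>))) ?AB"
      using A B by (subst (1 2) emeasure_distr) (auto intro!: arg_cong[where f = "emeasure M"])
    also have "\<dots> = (\<integral>\<^sup>+z. emeasure (?P \<Otimes>\<^sub>M ?Q) ((\<lambda>p. (p, z)) -` ?AB) \<partial>?R)"
      unfolding PQRlaw by (rule PQR.emeasure_pair_measure_alt2) (use AB in simp)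
    also have "\<dots> = (\<integral>\<^sup>+z. emeasure ?P ((\<lambda>x. (x, z)) -` A) * emeasure ?Q B \<partial>?R)"
    proof (intro nn_integral_cong)
      fix z
      have "(\<lambda>p. (p, z)) -` ?AB = ((\<lambda>x. (x, z)) -` A) \<times> B" by auto
      then show "emeasure (?P \<Otimes>\<^sub>M ?Q) ((\<lambda>p. (p, z)) -` ?AB) = emeasure ?P ((\<lambda>x. (x, z)) -` A) * emeasure ?Q B"
        using sets_Pair2[OF A, of z] B by (simp add: Q.emeasure_pair_measure_Times)
    qed
    also have "\<dots> = (\<integral>\<^sup>+z. emeasure ?P ((\<lambda>x. (x, z)) -` A) \<partial>?R) * emeasure ?Q B"
      by (rule nn_integral_multc) (rule PR.measurable_emeasure_Pair2[OF A])
    also have "\<dots> = emeasure (?P \<Otimes>\<^sub>M ?R) A * emeasure ?Q B"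
      by (subst PR.emeasure_pair_measure_alt2[OF A]) (rule refl)
    finally show "emeasure (?P \<Otimes>\<^sub>M ?R) A * emeasure ?Q B
        = emeasure (distr M ((S \<Otimes>\<^sub>M U) \<Otimes>\<^sub>M T) (\<lambda>\<omega>. ((X \<omega>, Z \<omega>), Y \<omega>))) (A \<times> B)" ..
  qed simp
  then show ?thesis
    by (simp add: indep_pair_def PRlaw eq)
qed

lemma (in prob_space) indep_pair_const:
  assumes [measurable]: "X \<in> measurable M S" and c: "c \<in> space T"
  shows "indep_pair S X T (\<lambda>_. c)"
proof -
  let ?P = "distr M S X" and ?Q = "distr M T (\<lambda>_. c)"
  interpret P: prob_space ?P by (rule prob_space_distr) simp
  interpret Q: prob_space ?Q by (rule prob_space_distr) (use c in simp)
  have eq: "?P \<Otimes>\<^sub>M ?Q = distr M (S \<Otimes>\<^sub>M T) (\<lambda>\<omega>. (X \<omega>, c))"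
  proof (rule pair_measure_eqI)
    fix A B assume AB: "A \<in> sets ?P" "B \<in> sets ?Q"
    have "(\<lambda>\<omega>. (X \<omega>, c)) -` (A \<times> B) \<inter> space M = (if c \<in> B then X -` A \<inter> space M else {})"
      by auto
    then show "emeasure ?P A * emeasure ?Q B = emeasure (distr M (S \<Otimes>\<^sub>M T) (\<lambda>\<omega>. (X \<omega>, c))) (A \<times> B)"
      using AB c by (simp add: emeasure_distr emeasure_space_1)
  qed (simp_all add: P.sigma_finite_measure_axioms Q.sigma_finite_measure_axioms)
  then show ?thesis
    using c by (simp add: indep_pair_def eq)
qed

section \<open>Sample mean and scatter of Gaussian vectors\<close>

text \<open>
  A shear translates each vertical fibre, which preserves Lebesgue measure on the fibre.
\<close>

lemma distr_lborel_shear_snd: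
  fixes h :: "'a::euclidean_space \<Rightarrow> 'b::euclidean_space"
  assumes [measurable]: "h \<in> borel_measurable borel"
  shows "distr (lborel \<Otimes>\<^sub>M lborel) (borel \<Otimes>\<^sub>M borel) (\<lambda>(x, y). (x, h x + y)) = lborel \<Otimes>\<^sub>M lborel"
proof (rule pair_measure_eqI[symmetric])
  fix A :: "'a set" and B :: "'b set" assume AB: "A \<in> sets lborel" "B \<in> sets lborel"
  then have [measurable]: "A \<in> sets borel" "B \<in> sets borel" by auto
  let ?T = "\<lambda>(x, y). (x, h x + y)"
  have T: "?T \<in> lborel \<Otimes>\<^sub>M lborel \<rightarrow>\<^sub>M borel \<Otimes>\<^sub>M borel"
    by (simp add: split_beta')
  have "emeasure (distr (lborel \<Otimes>\<^sub>M lborel) (borel \<Otimes>\<^sub>M borel) ?T) (A \<times> B)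
      = emeasure (lborel \<Otimes>\<^sub>M lborel) (?T -` (A \<times> B) \<inter> space (lborel \<Otimes>\<^sub>M lborel))"
    by (rule emeasure_distr[OF T]) simp
  also have "\<dots> = (\<integral>\<^sup>+x. emeasure lborel (Pair x -` (?T -` (A \<times> B) \<inter> space (lborel \<Otimes>\<^sub>M lborel))) \<partial>lborel)"
    by (rule lborel.emeasure_pair_measure_alt, rule measurable_sets[OF T]) simp
  also have "\<dots> = (\<integral>\<^sup>+x. emeasure lborel B * indicator A x \<partial>lborel)"
  proof (intro nn_integral_cong)
    fix x
    have "emeasure lborel ((\<lambda>y. h x + y) -` B) = emeasure (distr lborel borel ((+) (h x))) B"
      by (subst emeasure_distr) (auto simp: vimage_def)
    also have "\<dots> = emeasure lborel B" by (simp add: lborel_distr_plus)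
    finally have *: "emeasure lborel ((\<lambda>y. h x + y) -` B) = emeasure lborel B" .
    have "Pair x -` (?T -` (A \<times> B) \<inter> space (lborel \<Otimes>\<^sub>M lborel)) = (if x \<in> A then (\<lambda>y. h x + y) -` B else {})"
      by (auto simp: space_pair_measure)
    then show "emeasure lborel (Pair x -` (?T -` (A \<times> B) \<inter> space (lborel \<Otimes>\<^sub>M lborel)))
        = emeasure lborel B * indicator A x"
      by (simp add: *)
  qed
  also have "\<dots> = emeasure lborel A * emeasure lborel B"
    using AB by (subst nn_integral_cmult_indicator) (auto simp: mult.commute)
  finally show "emeasure lborel A * emeasure lborel B
      = emeasure (distr (lborel \<Otimes>\<^sub>M lborel) (borel \<Otimes>\<^sub>M borel) ?T) (A \<times> B)" ..
qed (auto intro: lborel.sigma_finite_measure_axioms intro!: sets_pair_measure_cong)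

lemma distr_lborel_shear_fst:
  fixes h :: "'a::euclidean_space \<Rightarrow> 'b::euclidean_space"
  assumes [measurable]: "h \<in> borel_measurable borel"
  shows "distr (lborel \<Otimes>\<^sub>M lborel) (borel \<Otimes>\<^sub>M borel) (\<lambda>(y, x). (h x + y, x)) = lborel \<Otimes>\<^sub>M lborel"
proof -
  have swap: "distr (lborel \<Otimes>\<^sub>M lborel) (borel \<Otimes>\<^sub>M borel) (\<lambda>(x, y). (y, x)) = (lborel \<Otimes>\<^sub>M lborel :: ('c::euclidean_space \<times> 'd::euclidean_space) measure)"
    by (subst (2) lborel_pair.distr_pair_swap) (intro distr_cong sets_pair_measure_cong; simp)
  \<comment> \<open>Conjugate the shear of the second coordinate with the exchange of coordinates.\<close>
  have "distr (lborel \<Otimes>\<^sub>M lborel) (borel \<Otimes>\<^sub>M borel) (\<lambda>(y, x). (h x + y, x))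
      = distr (distr (distr (lborel \<Otimes>\<^sub>M lborel) (borel \<Otimes>\<^sub>M borel) (\<lambda>(x, y). (y, x)))
          (borel \<Otimes>\<^sub>M borel) (\<lambda>(x, y). (x, h x + y))) (borel \<Otimes>\<^sub>M borel) (\<lambda>(x, y). (y, x))"
    by (simp add: distr_distr comp_def split_beta')
  also have "\<dots> = lborel \<Otimes>\<^sub>M lborel"
    by (simp only: swap distr_lborel_shear_snd[OF assms])
  finally show ?thesis .
qed

lemma distr_lborel_two_shears:
  "distr (lborel \<Otimes>\<^sub>M lborel) (borel \<Otimes>\<^sub>M borel) (\<lambda>(x, z). (x + k *\<^sub>R (z - x), z - x))
    = (lborel \<Otimes>\<^sub>M lborel :: ('a::euclidean_space \<times> 'a) measure)"
proof -
  have "distr (lborel \<Otimes>\<^sub>M lborel) (borel \<Otimes>\<^sub>M borel) (\<lambda>(x, z). (x + k *\<^sub>R (z - x), z - x))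
      = distr (distr (lborel \<Otimes>\<^sub>M lborel) (borel \<Otimes>\<^sub>M borel) (\<lambda>(x, z). (x, - x + z)))
          (borel \<Otimes>\<^sub>M borel) (\<lambda>(x :: 'a, d). (k *\<^sub>R d + x, d))"
    by (subst distr_distr) (auto simp: comp_def split_beta' add.commute)
  also have "\<dots> = lborel \<Otimes>\<^sub>M lborel"
    by (subst distr_lborel_shear_snd) (simp_all add: distr_lborel_shear_fst)
  finally show ?thesis .
qed

text \<open>
  The exponents agree because the quadratic form \<open>(norm x)\<^sup>2 / a + (norm z)\<^sup>2 /
  b\<close> becomes diagonal in the weighted mean of \<open>x\<close> and \<open>z\<close> and
  their difference; the constants agree because \<open>a * b = (a * b / (a + b)) * (a +
  b)\<close>.
\<close>

lemma mvnormal_density_product: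
  fixes x z :: "real^2"
  assumes ab: "a > 0" "b > 0"
  shows "mvnormal_density 0 (mat a) x * mvnormal_density 0 (mat b) z
    = mvnormal_density 0 (mat (a * b / (a + b))) (x + (a / (a + b)) *\<^sub>R (z - x))
      * mvnormal_density 0 (mat (a + b)) (z - x)"
proof -
  have pos: "a + b > 0" "a * b / (a + b) > 0" using ab by (auto intro: add_pos_pos)
  define k where "k = a / (a + b)"
  define s where "s = a + b"
  have b: "b = s - a" and k: "k = a / s" and s: "s > 0" "s \<noteq> 0" "s - a > 0" "a \<noteq> 0" "s - a \<noteq> 0"
    using ab by (auto simp: s_def k_def)
  have sq: "(norm (x + k *\<^sub>R (z - x)))\<^sup>2
      = (1 - k)\<^sup>2 * (x \<bullet> x) + 2 * k * (1 - k) * (x \<bullet> z) + k\<^sup>2 * (z \<bullet> z)"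
    unfolding power2_norm_eq_inner
    by (simp add: inner_simps inner_commute[of z x] power2_eq_square algebra_simps)
  have sq': "(norm (z - x))\<^sup>2 = x \<bullet> x - 2 * (x \<bullet> z) + z \<bullet> z"
    unfolding power2_norm_eq_inner by (simp add: inner_simps inner_commute[of z x])
  have "(norm (x + k *\<^sub>R (z - x)))\<^sup>2 / (2 * (a * b / (a + b))) + (norm (z - x))\<^sup>2 / (2 * (a + b))
      = (norm x)\<^sup>2 / (2 * a) + (norm z)\<^sup>2 / (2 * b)"
    unfolding sq sq' power2_norm_eq_inner[of x] power2_norm_eq_inner[of z]
    unfolding b k
    using s by (simp add: divide_simps power2_eq_square) (simp add: algebra_simps)
  then have "exp (- (norm x)\<^sup>2 / (2 * a)) * exp (- (norm z)\<^sup>2 / (2 * b))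
      = exp (- (norm (x + k *\<^sub>R (z - x)))\<^sup>2 / (2 * (a * b / (a + b))))
        * exp (- (norm (z - x))\<^sup>2 / (2 * (a + b)))"
    by (simp add: exp_add[symmetric])
  moreover have "(2 * pi * a) * (2 * pi * b) = (2 * pi * (a * b / (a + b))) * (2 * pi * (a + b))"
    using pos by simp
  ultimately show ?thesis
    unfolding mvnormal_density_mat[OF ab(1)] mvnormal_density_mat[OF ab(2)]
      mvnormal_density_mat[OF pos(1)] mvnormal_density_mat[OF pos(2)] k_def diff_0_right times_divide_times_eq
    by (simp only:)
qed

text \<open>
  The combination \<open>Y\<close> is the mean of \<open>X\<close> and \<open>Z\<close> weighted
  inversely to their variances, which makes it uncorrelated with the difference \<open>D\<close>.
\<close>

lemma (in prob_space) gaussian_update: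
  fixes X Z :: "'a \<Rightarrow> real^2"
  assumes ab: "a > 0" "b > 0"
    and X: "distributed M lborel X (mvnormal_density 0 (mat a))"
    and Z: "distributed M lborel Z (mvnormal_density 0 (mat b))"
    and XZ: "indep_pair borel X borel Z"
  defines "Y \<equiv> \<lambda>\<omega>. X \<omega> + (a / (a + b)) *\<^sub>R (Z \<omega> - X \<omega>)" and "D \<equiv> \<lambda>\<omega>. Z \<omega> - X \<omega>"
  shows "indep_pair borel Y borel D"
    and "distributed M lborel Y (mvnormal_density 0 (mat (a * b / (a + b))))"
    and "distributed M lborel D (mvnormal_density 0 (mat (a + b)))"
proof -
  note [measurable] = distributed_borel_measurable_lborel[OF X] distributed_borel_measurable_lborel[OF Z]
  have [measurable]: "Y \<in> borel_measurable M" "D \<in> borel_measurable M"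
    by (auto simp: Y_def D_def)
  have pos: "a + b > 0" "a * b / (a + b) > 0" using ab by (auto intro: add_pos_pos)
  let ?g = "\<lambda>c. \<lambda>x :: real^2. ennreal (mvnormal_density 0 (mat c) x)"
  let ?T = "\<lambda>(x :: real^2, z). (x + (a / (a + b)) *\<^sub>R (z - x), z - x)"
  let ?P = "density lborel (?g (a * b / (a + b)))" and ?Q = "density lborel (?g (a + b))"
  have sf: "sigma_finite_measure (density lborel (?g c))" if "c > 0" for c
    using prob_space_mvnormal_density[OF that] by (simp add: prob_space_def finite_measure.axioms(1))
  have g: "?g a x * ?g b z = (\<lambda>(y, d). ?g (a * b / (a + b)) y * ?g (a + b) d) (?T (x, z))" for x z
  proof -
    have "?g a x * ?g b z = ennreal (mvnormal_density 0 (mat a) x * mvnormal_density 0 (mat b) z)"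
      using ln_mvnormal_density_mat(1)[OF ab(1), of 0 x] by (simp add: ennreal_mult')
    also have "\<dots> = ?g (a * b / (a + b)) (x + (a / (a + b)) *\<^sub>R (z - x)) * ?g (a + b) (z - x)"
      unfolding mvnormal_density_product[OF ab]
      using ln_mvnormal_density_mat(1)[OF pos(2), of 0] by (simp add: ennreal_mult' less_imp_le)
    finally show ?thesis by simp
  qed
  have "distr M (borel \<Otimes>\<^sub>M borel) (\<lambda>\<omega>. (Y \<omega>, D \<omega>))
      = distr (distr M (borel \<Otimes>\<^sub>M borel) (\<lambda>\<omega>. (X \<omega>, Z \<omega>))) (borel \<Otimes>\<^sub>M borel) ?T"
    by (subst distr_distr) (auto simp: comp_def split_beta' Y_def D_def)
  also have "distr M (borel \<Otimes>\<^sub>M borel) (\<lambda>\<omega>. (X \<omega>, Z \<omega>))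
      = density lborel (?g a) \<Otimes>\<^sub>M density lborel (?g b)"
    using XZ X Z by (simp add: indep_pair_def distributed_def cong: distr_cong)
  also have "\<dots> = density (lborel \<Otimes>\<^sub>M lborel) (\<lambda>(x, z). ?g a x * ?g b z)"
    by (rule pair_measure_density) (auto intro: lborel.sigma_finite_measure_axioms sf ab)
  also have "(\<lambda>(x, z). ?g a x * ?g b z) = (\<lambda>p. (\<lambda>(y, d). ?g (a * b / (a + b)) y * ?g (a + b) d) (?T p))"
  proof (rule ext)
    show "(case p of (x, z) \<Rightarrow> ?g a x * ?g b z)
        = (\<lambda>(y, d). ?g (a * b / (a + b)) y * ?g (a + b) d) (?T p)" for p
      by (cases p) (simp only: g prod.case)
  qed
  also have "distr (density (lborel \<Otimes>\<^sub>M lborel) \<dots>) (borel \<Otimes>\<^sub>M borel) ?T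
      = density (distr (lborel \<Otimes>\<^sub>M lborel) (borel \<Otimes>\<^sub>M borel) ?T)
          (\<lambda>(y, d). ?g (a * b / (a + b)) y * ?g (a + b) d)"
    by (rule density_distr[symmetric]) (auto simp: split_beta')
  also have "\<dots> = ?P \<Otimes>\<^sub>M ?Q"
    unfolding distr_lborel_two_shears
    by (rule pair_measure_density[symmetric]) (auto intro: lborel.sigma_finite_measure_axioms sf pos)
  finally have law: "distr M (borel \<Otimes>\<^sub>M borel) (\<lambda>\<omega>. (Y \<omega>, D \<omega>)) = ?P \<Otimes>\<^sub>M ?Q" .
  have "indep_pair borel Y borel D" "distr M borel Y = ?P" "distr M borel D = ?Q"
    by (rule indep_pair_if_product_law[OF _ _ law];
        simp add: prob_space_mvnormal_density pos)+
  then show "indep_pair borel Y borel D"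
    and "distributed M lborel Y (mvnormal_density 0 (mat (a * b / (a + b))))"
    and "distributed M lborel D (mvnormal_density 0 (mat (a + b)))"
    by (auto simp: distributed_def cong: distr_cong)
qed

definition sample_mean :: "(nat \<Rightarrow> 'a \<Rightarrow> 'b::real_vector) \<Rightarrow> nat \<Rightarrow> 'a \<Rightarrow> 'b" where
  "sample_mean Z n \<omega> = (1 / real (n + 1)) *\<^sub>R (\<Sum>t=0..n. Z t \<omega>)"

definition sample_scatter :: "(nat \<Rightarrow> 'a \<Rightarrow> 'b::real_normed_vector) \<Rightarrow> nat \<Rightarrow> 'a \<Rightarrow> real" where
  "sample_scatter Z n \<omega> = (\<Sum>t=0..n. (norm (Z t \<omega> - sample_mean Z n \<omega>))\<^sup>2)"

lemma sample_mean_Suc: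
  "sample_mean Z (Suc n) \<omega> = sample_mean Z n \<omega> + (1 / real (n + 2)) *\<^sub>R (Z (Suc n) \<omega> - sample_mean Z n \<omega>)"
proof -
  define S where "S = (\<Sum>t=0..n. Z t \<omega>)"
  have "sample_mean Z (Suc n) \<omega> = (1 / real (n + 2)) *\<^sub>R S + (1 / real (n + 2)) *\<^sub>R Z (Suc n) \<omega>"
    by (simp add: sample_mean_def S_def scaleR_add_right)
  also have "(1 / real (n + 2)) *\<^sub>R S = (1 / real (n + 1) - 1 / real (n + 2) * (1 / real (n + 1))) *\<^sub>R S"
  proof (rule arg_cong[where f = "\<lambda>r. r *\<^sub>R S"])
    have "real n + 1 > 0" "real n + 2 > 0" by linarith+
    then show "1 / real (n + 2) = 1 / real (n + 1) - 1 / real (n + 2) * (1 / real (n + 1))"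
      by (simp add: divide_simps)
  qed
  finally show ?thesis
    by (simp add: sample_mean_def S_def scaleR_diff_right scaleR_diff_left)
qed

text \<open>
  The decomposition of squared distances from a point \<open>m\<close> (parallel axis theorem). It
  serves both the recursion for the scatter and the dependence of the likelihood on the mean.
\<close>

lemma sum_square_distance_eq_scatter:
  fixes Z :: "nat \<Rightarrow> 'a \<Rightarrow> 'b::real_inner"
  shows "(\<Sum>t=0..n. (norm (Z t \<omega> - m))\<^sup>2)
    = sample_scatter Z n \<omega> + real (n + 1) * (norm (sample_mean Z n \<omega> - m))\<^sup>2"
proof -
  define b where "b = sample_mean Z n \<omega>"
  have sum: "(\<Sum>t=0..n. Z t \<omega> - b) = 0"
    by (simp add: b_def sample_mean_def sum_subtractf sum_constant_scaleR)
  have "(norm (Z t \<omega> - m))\<^sup>2 = (norm (Z t \<omega> - b))\<^sup>2 + 2 * ((Z t \<omega> - b) \<bullet> (b - m)) + (norm (b - m))\<^sup>2" for t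
    unfolding power2_norm_eq_inner by (simp add: inner_simps inner_commute)
  then have "(\<Sum>t=0..n. (norm (Z t \<omega> - m))\<^sup>2)
      = sample_scatter Z n \<omega> + 2 * ((\<Sum>t=0..n. Z t \<omega> - b) \<bullet> (b - m)) + real (n + 1) * (norm (b - m))\<^sup>2"
    by (simp add: sample_scatter_def b_def[symmetric] sum.distrib sum_distrib_left[symmetric]
        inner_sum_left[symmetric])
  then show ?thesis
    using sum by (simp add: b_def)
qed

lemma sample_scatter_Suc:
  fixes Z :: "nat \<Rightarrow> 'a \<Rightarrow> 'b::real_inner"
  shows "sample_scatter Z (Suc n) \<omega>
    = sample_scatter Z n \<omega> + real (n + 1) / real (n + 2) * (norm (Z (Suc n) \<omega> - sample_mean Z n \<omega>))\<^sup>2"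
proof -
  define b where "b = sample_mean Z n \<omega>"
  define d where "d = Z (Suc n) \<omega> - b"
  define b' where "b' = sample_mean Z (Suc n) \<omega>"
  have b': "b' - b = (1 / real (n + 2)) *\<^sub>R d"
    by (simp add: b'_def b_def d_def sample_mean_Suc)
  \<comment> \<open>The squared distances of all observations from the old mean, summed in two ways.\<close>
  have "sample_scatter Z (Suc n) \<omega> + real (n + 2) * (norm (b' - b))\<^sup>2 = (\<Sum>t=0..Suc n. (norm (Z t \<omega> - b))\<^sup>2)"
    using sum_square_distance_eq_scatter[of Z \<omega> b "Suc n"] by (simp add: b'_def)
  also have "\<dots> = sample_scatter Z n \<omega> + (norm d)\<^sup>2"
    by (simp add: sample_scatter_def b_def d_def)
  finally have "sample_scatter Z (Suc n) \<omega>
      = sample_scatter Z n \<omega> + ((norm d)\<^sup>2 - real (n + 2) * (1 / real (n + 2))\<^sup>2 * (norm d)\<^sup>2)"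
    by (simp add: b' power_mult_distrib power_divide)
  also have "(norm d)\<^sup>2 - real (n + 2) * (1 / real (n + 2))\<^sup>2 * (norm d)\<^sup>2 = real (n + 1) / real (n + 2) * (norm d)\<^sup>2"
  proof -
    have "real (n + 2) * (1 / real (n + 2))\<^sup>2 = 1 / real (n + 2)"
      by (simp add: power2_eq_square)
    moreover have "real (n + 1) / real (n + 2) = 1 - 1 / real (n + 2)"
      by (simp add: field_simps)
    ultimately show ?thesis
      by (simp only: left_diff_distrib mult_1)
  qed
  finally show ?thesis
    by (simp add: d_def b_def)
qed

lemma sample_mean_measurable [measurable]:
  fixes Z :: "nat \<Rightarrow> 'a \<Rightarrow> 'b::euclidean_space"
  assumes [measurable]: "\<And>t. t \<le> n \<Longrightarrow> Z t \<in> borel_measurable M"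
  shows "sample_mean Z n \<in> borel_measurable M"
  unfolding sample_mean_def[abs_def] by measurable

lemma sample_scatter_measurable [measurable]:
  fixes Z :: "nat \<Rightarrow> 'a \<Rightarrow> 'b::euclidean_space"
  assumes [measurable]: "\<And>t. t \<le> n \<Longrightarrow> Z t \<in> borel_measurable M"
  shows "sample_scatter Z n \<in> borel_measurable M"
  unfolding sample_scatter_def[abs_def] by measurable

lemma sample_mean_translate: "(\<And>t. Z t \<omega> = m + Y t \<omega>) \<Longrightarrow> sample_mean Z n \<omega> = m + sample_mean Y n \<omega>"
  by (simp add: sample_mean_def sum.distrib scaleR_add_right sum_constant_scaleR)

lemma sample_scatter_translate:
  assumes "\<And>t. Z t \<omega> = m + Y t \<omega>" shows "sample_scatter Z n \<omega> = sample_scatter Y n \<omega>"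
  by (simp add: sample_scatter_def sample_mean_translate[of Z \<omega> m Y, OF assms] assms)

text \<open>
  Independence of mean and scatter belongs to the induction hypothesis, because it makes the next
  increment independent of the old scatter. For a single observation the scatter is constantly 0
  and has no density, hence the restriction to \<open>n \<ge> 1\<close> in the last part.
\<close>

lemma (in prob_space) gaussian_sample:
  fixes Z :: "nat \<Rightarrow> 'a \<Rightarrow> real^2"
  assumes c: "c > 0"
    and ind: "indep_vars (\<lambda>_. borel) Z UNIV"
    and Z: "\<And>t. distributed M lborel (Z t) (mvnormal_density 0 (mat c))"
  shows "indep_pair borel (sample_mean Z n) borel (sample_scatter Z n)
    \<and> distributed M lborel (sample_mean Z n) (mvnormal_density 0 (mat (c / real (n + 1))))
    \<and> (n \<ge> 1 \<longrightarrow> distributed M lborel (\<lambda>\<omega>. sample_scatter Z n \<omega> / c) (erlang_density (n - 1) (1 / 2)))"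
proof (induction n)
  case 0
  have "sample_mean Z 0 = Z 0" "sample_scatter Z 0 = (\<lambda>_. 0)"
    by (auto simp: sample_mean_def[abs_def] sample_scatter_def[abs_def])
  then show ?case
    using Z[of 0] indep_pair_const[OF distributed_borel_measurable_lborel[OF Z[of 0]], of 0 borel] by simp
next
  case (Suc n)
  note [measurable] = distributed_borel_measurable_lborel[OF Z]
  let ?m = "sample_mean Z n" and ?S = "sample_scatter Z n" and ?Z = "Z (Suc n)"
  let ?a = "c / real (n + 1)"
  define \<kappa> where "\<kappa> = ?a / (?a + c)"
  define Y where "Y = (\<lambda>\<omega>. ?m \<omega> + \<kappa> *\<^sub>R (?Z \<omega> - ?m \<omega>))"
  define D where "D = (\<lambda>\<omega>. ?Z \<omega> - ?m \<omega>)"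
  have a: "?a > 0" "?a + c = c * (real (n + 2) / real (n + 1))" "?a / (?a + c) = 1 / real (n + 2)"
    "?a * c / (?a + c) = c / real (Suc n + 1)"
  proof -
    define r where "r = real (n + 1)"
    have r: "real (n + 2) = r + 1" "real (Suc n + 1) = r + 1" "r > 0" "r + 1 > 0"
      by (simp_all add: r_def)
    have sum: "c / r + c = c * ((r + 1) / r)"
      using r(3) by (simp add: field_simps)
    show "?a > 0" "?a + c = c * (real (n + 2) / real (n + 1))" "?a / (?a + c) = 1 / real (n + 2)"
      "?a * c / (?a + c) = c / real (Suc n + 1)"
      unfolding r_def[symmetric] r(1,2) sum using c r(3,4) by simp_all
  qed
  have m_Suc: "sample_mean Z (Suc n) = Y"
    unfolding Y_def \<kappa>_def a(3) by (rule ext) (rule sample_mean_Suc)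
  have S_Suc: "sample_scatter Z (Suc n) = (\<lambda>\<omega>. ?S \<omega> + real (n + 1) / real (n + 2) * (norm (D \<omega>))\<^sup>2)"
    unfolding D_def by (rule ext) (rule sample_scatter_Suc)
  have mS: "indep_pair borel ?m borel ?S"
    and m: "distributed M lborel ?m (mvnormal_density 0 (mat ?a))"
    using Suc.IH by auto
  \<comment> \<open>Mean and scatter of the first observations are functions of the block of indices up to \<open>n\<close>.\<close>
  have past: "indep_pair (borel \<Otimes>\<^sub>M borel) (\<lambda>\<omega>. (?m \<omega>, ?S \<omega>)) borel ?Z"
  proof -
    let ?r = "\<lambda>A \<omega>. restrict (\<lambda>t. Z t \<omega>) A"
    have "indep_pair (PiM {..n} (\<lambda>_. borel)) (?r {..n}) (PiM {Suc n} (\<lambda>_. borel)) (?r {Suc n})"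
      unfolding indep_pair_iff_indep_var by (rule indep_var_restrict[OF ind]) auto
    moreover have "(\<lambda>f. (sample_mean (\<lambda>t f. f t) n f, sample_scatter (\<lambda>t f. f t) n f))
        \<in> PiM {..n} (\<lambda>_. borel :: (real^2) measure) \<rightarrow>\<^sub>M borel \<Otimes>\<^sub>M borel"
      by (intro measurable_Pair sample_mean_measurable sample_scatter_measurable) auto
    moreover have "(\<lambda>f. f (Suc n)) \<in> PiM {Suc n} (\<lambda>_. borel :: (real^2) measure) \<rightarrow>\<^sub>M borel"
      by simp
    ultimately have "indep_pair (borel \<Otimes>\<^sub>M borel)
        (\<lambda>\<omega>. (\<lambda>f. (sample_mean (\<lambda>t f. f t) n f, sample_scatter (\<lambda>t f. f t) n f)) (?r {..n} \<omega>))
        borel (\<lambda>\<omega>. (\<lambda>f. f (Suc n)) (?r {Suc n} \<omega>))"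
      by (rule indep_pair_compose)
    then show ?thesis
      by (simp add: sample_mean_def sample_scatter_def)
  qed
  have mZ: "indep_pair borel ?m borel ?Z"
    using indep_pair_compose[OF past, of fst borel "\<lambda>z. z" borel] by simp
  note upd = gaussian_update[OF a(1) c m Z mZ, folded \<kappa>_def, folded Y_def D_def]
  have "indep_pair (borel \<Otimes>\<^sub>M borel) (\<lambda>\<omega>. (?m \<omega>, ?Z \<omega>)) borel ?S"
    by (rule indep_pair_swap[OF mS past])
  moreover have "(\<lambda>(m, z). (z - m, m + \<kappa> *\<^sub>R (z - m))) \<in> borel \<Otimes>\<^sub>M borel \<rightarrow>\<^sub>M borel \<Otimes>\<^sub>M (borel :: (real^2) measure)"
    by (simp add: split_beta')
  ultimately have "indep_pair (borel \<Otimes>\<^sub>M borel)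
      (\<lambda>\<omega>. (\<lambda>(m, z). (z - m, m + \<kappa> *\<^sub>R (z - m))) (?m \<omega>, ?Z \<omega>)) borel (\<lambda>\<omega>. (\<lambda>s. s) (?S \<omega>))"
    by (rule indep_pair_compose) simp
  then have DYS: "indep_pair (borel \<Otimes>\<^sub>M borel) (\<lambda>\<omega>. (D \<omega>, Y \<omega>)) borel ?S"
    unfolding D_def Y_def by (simp only: prod.case)
  \<comment> \<open>Regroup (increment, new mean) and old scatter so that the new mean stands alone.\<close>
  have DSY: "indep_pair (borel \<Otimes>\<^sub>M borel) (\<lambda>\<omega>. (D \<omega>, ?S \<omega>)) borel Y"
    by (rule indep_pair_swap[OF indep_pair_sym[OF upd(1)] DYS])
  have "indep_pair borel Y borel (sample_scatter Z (Suc n))"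
  proof (rule indep_pair_sym)
    define r where "r = real (n + 1) / real (n + 2)"
    have "(\<lambda>(d, s). s + r * (norm d)\<^sup>2) \<in> borel \<Otimes>\<^sub>M borel \<rightarrow>\<^sub>M borel" for d :: "real^2"
      by (simp add: split_beta')
    then have "indep_pair borel (\<lambda>\<omega>. (\<lambda>(d, s). s + r * (norm d)\<^sup>2) (D \<omega>, ?S \<omega>)) borel (\<lambda>\<omega>. (\<lambda>y. y) (Y \<omega>))"
      by (intro indep_pair_compose[OF DSY]) simp_all
    then show "indep_pair borel (sample_scatter Z (Suc n)) borel Y"
      unfolding S_Suc r_def[symmetric] by (simp only: prod.case)
  qed
  moreover have "distributed M lborel Y (mvnormal_density 0 (mat (c / real (Suc n + 1))))"
    using upd(2) unfolding a(4) .
  moreover have "distributed M lborel (\<lambda>\<omega>. sample_scatter Z (Suc n) \<omega> / c) (erlang_density n (1 / 2))"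
  proof -
    have "?a + c > 0" using a(1) c by (rule add_pos_pos)
    from mvnormal_norm_square[OF upd(3) this]
    have E: "distributed M lborel (\<lambda>\<omega>. (norm (D \<omega>))\<^sup>2 / (?a + c)) (exponential_density (1 / 2))" .
    have eq: "sample_scatter Z (Suc n) \<omega> / c = ?S \<omega> / c + (norm (D \<omega>))\<^sup>2 / (?a + c)" for \<omega>
    proof -
      have "p / r * q / c = q / (c * (r / p))" for p q r :: real
        by (simp add: mult.commute)
      then show ?thesis
        unfolding S_Suc a(2) add_divide_distrib by simp
    qed
    show ?thesis
    proof (cases "n = 0")
      case True
      then have "?S \<omega> = 0" for \<omega>
        by (simp add: sample_mean_def sample_scatter_def)
      then show ?thesis
        unfolding eq using E True by simp
    next
      case False
      have "indep_pair borel D borel ?S"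
        using indep_pair_compose[OF DYS, of fst borel "\<lambda>s. s" borel] by simp
      moreover have "(\<lambda>d :: real^2. (norm d)\<^sup>2 / k) \<in> borel_measurable borel" "(\<lambda>s. s / c) \<in> borel_measurable borel" for k
        by simp_all
      ultimately have "indep_pair borel (\<lambda>\<omega>. (norm (D \<omega>))\<^sup>2 / (?a + c)) borel (\<lambda>\<omega>. ?S \<omega> / c)"
        by (rule indep_pair_compose)
      then have "indep_var borel (\<lambda>\<omega>. ?S \<omega> / c) borel (\<lambda>\<omega>. (norm (D \<omega>))\<^sup>2 / (?a + c))"
        unfolding indep_pair_iff_indep_var[symmetric] by (rule indep_pair_sym)
      then have "distributed M lborel (\<lambda>\<omega>. ?S \<omega> / c + (norm (D \<omega>))\<^sup>2 / (?a + c))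
          (erlang_density (Suc (n - 1) + Suc 0 - 1) (1 / 2))"
        using Suc.IH False by (intro sum_indep_erlang E) auto
      then show ?thesis
        unfolding eq using False by simp
    qed
  qed
  ultimately show ?case
    unfolding m_Suc by simp
qed

section \<open>Chi-square laws and consistency\<close>

text \<open>
  At 0 the two densities differ for \<open>k = 0\<close>, where the Erlang density has the value
  1/2.
\<close>

lemma erlang_density_eq_chi_square_density:
  assumes "x \<noteq> 0"
  shows "erlang_density k (1 / 2) x = chi_square_density (2 * Suc k) x"
proof (cases "x > 0")
  case True
  have half: "real (2 * Suc k) / 2 = real k + 1"
    by simp
  have "x powr (real k + 1 - 1) = x ^ k"
    using True by (simp add: powr_realpow)
  moreover have "(2::real) powr (real k + 1) = 2 ^ Suc k"
    using powr_realpow[of 2 "Suc k"] by (simp add: add.commute)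
  moreover have "Gamma (real k + 1) = fact k"
    using Gamma_fact[of k, where 'a=real] by (simp add: add.commute)
  ultimately show ?thesis
    using True unfolding chi_square_density_def erlang_density_def half
    by (simp add: power_one_over field_simps)
qed (use assms in \<open>simp add: erlang_density_def chi_square_density_def\<close>)

lemma borel_measurable_chi_square_density [measurable]:
  "chi_square_density k \<in> borel_measurable borel"
  unfolding chi_square_density_def[abs_def] by measurable

lemma distributed_erlang_imp_chi_square:
  assumes "distributed M lborel X (erlang_density k (1 / 2))"
  shows "distributed M lborel X (chi_square_density (2 * Suc k))"
proof (rule distributed_cong_density[THEN iffD1, OF _ _ _ assms])
  show "AE x in lborel. ennreal (erlang_density k (1 / 2) x) = ennreal (chi_square_density (2 * Suc k) x)"
    using AE_lborel_singleton[of "0::real"]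
    by eventually_elim (subst erlang_density_eq_chi_square_density, assumption, rule refl)
qed simp_all

lemma (in prob_space) erlang_mean_square_deviation:
  assumes X: "distributed M lborel X (erlang_density k (1 / 2))"
  defines "n \<equiv> real (Suc k)"
  shows "integrable M (\<lambda>\<omega>. (X \<omega> - b)\<^sup>2)"
    and "expectation (\<lambda>\<omega>. (X \<omega> - b)\<^sup>2) = 4 * n * (n + 1) - 4 * b * n + b\<^sup>2"
proof -
  have i: "integrable M X" "integrable M (\<lambda>\<omega>. (X \<omega>)\<^sup>2)"
    using erlang_ith_moment_integrable[OF _ X, of 1] erlang_ith_moment_integrable[OF _ X, of 2] by auto
  have m: "expectation X = 2 * n" "expectation (\<lambda>\<omega>. (X \<omega>)\<^sup>2) = 4 * n * (n + 1)"
  proof -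
    have fact: "fact (k + 1) = n * fact k" "fact (k + 2) = (n + 1) * (n * fact k)"
      by (simp_all add: n_def)
    show "expectation X = 2 * n"
      using erlang_ith_moment[OF _ X, of 1] unfolding fact by simp
    show "expectation (\<lambda>\<omega>. (X \<omega>)\<^sup>2) = 4 * n * (n + 1)"
      using erlang_ith_moment[OF _ X, of 2] unfolding fact by (simp add: power_one_over)
  qed
  have eq: "(X \<omega> - b)\<^sup>2 = (X \<omega>)\<^sup>2 - 2 * b * X \<omega> + b\<^sup>2" for \<omega>
    by (simp add: power2_eq_square algebra_simps)
  show "integrable M (\<lambda>\<omega>. (X \<omega> - b)\<^sup>2)"
    unfolding eq using i by simp
  show "expectation (\<lambda>\<omega>. (X \<omega> - b)\<^sup>2) = 4 * n * (n + 1) - 4 * b * n + b\<^sup>2"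
    unfolding eq using i m by (simp add: prob_space)
qed

lemma (in prob_space) consistent_mean:
  fixes est :: "nat \<Rightarrow> 'a \<Rightarrow> real^2"
  assumes est: "\<And>T. distributed M lborel (est T) (mvnormal_density m (mat (c / real (T + 1))))" and c: "c > 0"
  shows "consistent_estimator est m"
  unfolding consistent_estimator_def
proof (intro conjI allI impI)
  fix T show "est T \<in> borel_measurable M"
    by (rule distributed_borel_measurable_lborel[OF est])
next
  fix e :: real assume e: "e > 0"
  have "prob {\<omega> \<in> space M. dist (est T \<omega>) m > e} = exp (- (e\<^sup>2 / c / 2) * real (T + 1))" for T
  proof -
    let ?c = "c / real (T + 1)"
    have c': "?c > 0" using c by simp
    have "distributed M lborel (\<lambda>\<omega>. - m + est T \<omega>) (mvnormal_density (- m + m) (mat ?c))"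
      by (rule distributed_mvnormal_translate[OF est c'])
    then have "distributed M lborel (\<lambda>\<omega>. - m + est T \<omega>) (mvnormal_density 0 (mat ?c))"
      by simp
    \<comment> \<open>The squared deviation, divided by its variance, is exponential with rate 1/2.\<close>
    note E = mvnormal_norm_square[OF this c']
    have "e < dist (est T \<omega>) m \<longleftrightarrow> e\<^sup>2 / ?c < (norm (- m + est T \<omega>))\<^sup>2 / ?c" for \<omega>
    proof -
      have "e < dist (est T \<omega>) m \<longleftrightarrow> e < norm (- m + est T \<omega>)"
        by (simp add: dist_norm)
      also have "\<dots> \<longleftrightarrow> e\<^sup>2 < (norm (- m + est T \<omega>))\<^sup>2"
        using e by (auto intro!: power_strict_mono dest: power_less_imp_less_base)
      finally show ?thesis using c c' by (simp add: divide_less_cancel)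
    qed
    then have "prob {\<omega> \<in> space M. dist (est T \<omega>) m > e}
        = \<P>(\<omega> in M. e\<^sup>2 / ?c < (norm (- m + est T \<omega>))\<^sup>2 / ?c)"
      by simp
    also have "\<dots> = exp (- (e\<^sup>2 / ?c) * (1 / 2))"
      by (rule exponential_distributedD_gt[OF E]) (use c in auto)
    finally show ?thesis using c by (simp add: field_simps)
  qed
  moreover have "(\<lambda>T. exp (- (e\<^sup>2 / c / 2) * real (T + 1))) \<longlonglongrightarrow> 0"
  proof -
    have "exp (- (e\<^sup>2 / c / 2)) < 1" using e c by simp
    then have "(\<lambda>T. exp (- (e\<^sup>2 / c / 2)) ^ Suc T) \<longlonglongrightarrow> 0"
      by (intro LIMSEQ_Suc LIMSEQ_realpow_zero) auto
    then show ?thesis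
      by (simp only: exp_of_nat2_mult[symmetric] Suc_eq_plus1)
  qed
  ultimately show "(\<lambda>T. prob {\<omega> \<in> space M. dist (est T \<omega>) m > e}) \<longlonglongrightarrow> 0"
    by simp
qed

text \<open>
  For scatters in the plane \<open>k\<close> counts the families of vectors that contribute:
  \<open>2 * k * T\<close> degrees of freedom are left of the \<open>2 * k * (T + 1)\<close>
  coordinates. The bias that this causes vanishes in the limit, so the deviation is measured from
  the true value instead of the expectation.
\<close>

lemma (in prob_space) consistent_variance:
  fixes est :: "nat \<Rightarrow> 'a \<Rightarrow> real" and k :: nat
  assumes meas: "\<And>T. est T \<in> borel_measurable M"
    and est: "\<And>T. T \<ge> 1 \<Longrightarrow>
      distributed M lborel (\<lambda>\<omega>. 2 * real k * real (T + 1) * est T \<omega> / c) (erlang_density (k * T - 1) (1 / 2))"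
    and c: "c > 0" and k: "k \<ge> 1"
  shows "consistent_estimator est c"
  unfolding consistent_estimator_def
proof (intro conjI allI impI meas)
  fix e :: real assume e: "e > 0"
  have bound: "prob {\<omega> \<in> space M. dist (est T \<omega>) c > e} \<le> c\<^sup>2 / e\<^sup>2 * inverse (real (Suc T))" if T: "T \<ge> 1" for T
  proof -
    define b where "b = 2 * real k * real (T + 1)"
    define Y where "Y = (\<lambda>\<omega>. b * est T \<omega> / c)"
    define n where "n = real k * real T"
    define t where "t = e * b / c"
    have b: "b > 0" using k by (simp add: b_def)
    have t: "t > 0" using b e c by (simp add: t_def)
    have D: "distributed M lborel Y (erlang_density (k * T - 1) (1 / 2))"
      using est[OF T] unfolding Y_def b_def by simp
    have [measurable]: "Y \<in> borel_measurable M"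
      by (rule distributed_borel_measurable_lborel[OF D])
    have "k * T \<ge> 1" using k T by simp
    then have n: "real (Suc (k * T - 1)) = n" by (simp add: n_def)
    note I = erlang_mean_square_deviation[OF D, of b, unfolded n]
    have "b = 2 * n + 2 * real k" by (simp add: b_def n_def algebra_simps)
    then have E: "expectation (\<lambda>\<omega>. (Y \<omega> - b)\<^sup>2) = 4 * n + 4 * (real k)\<^sup>2"
      unfolding I(2) by (simp add: power2_eq_square algebra_simps)
    have "prob {\<omega> \<in> space M. dist (est T \<omega>) c > e} \<le> prob {\<omega> \<in> space M. t\<^sup>2 \<le> (Y \<omega> - b)\<^sup>2}"
    proof (rule finite_measure_mono)
      show "{\<omega> \<in> space M. dist (est T \<omega>) c > e} \<subseteq> {\<omega> \<in> space M. t\<^sup>2 \<le> (Y \<omega> - b)\<^sup>2}"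
      proof safe
        fix \<omega> assume "e < dist (est T \<omega>) c"
        then have "e * (b / c) \<le> \<bar>est T \<omega> - c\<bar> * (b / c)"
          using b c by (intro mult_right_mono) (auto simp: dist_real_def)
        also have "\<dots> = \<bar>(est T \<omega> - c) * (b / c)\<bar>"
          using b c by (simp add: abs_mult)
        also have "(est T \<omega> - c) * (b / c) = Y \<omega> - b"
          using c by (simp add: Y_def field_simps)
        finally have "t \<le> \<bar>Y \<omega> - b\<bar>" by (simp add: t_def)
        then have "t\<^sup>2 \<le> \<bar>Y \<omega> - b\<bar>\<^sup>2" using t by (intro power_mono) auto
        then show "t\<^sup>2 \<le> (Y \<omega> - b)\<^sup>2" by simp
      qed
    qed measurable
    also have "\<dots> \<le> expectation (\<lambda>\<omega>. (Y \<omega> - b)\<^sup>2) / t\<^sup>2"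
      using t by (intro integral_Markov_inequality_measure[where A = "{}"] I(1)) auto
    also have "\<dots> = c\<^sup>2 / e\<^sup>2 * ((n + (real k)\<^sup>2) / (real k * real (T + 1))\<^sup>2)"
    proof -
      have t: "t\<^sup>2 = 4 * (e\<^sup>2 / c\<^sup>2 * (real k * real (T + 1))\<^sup>2)"
        by (simp add: t_def b_def power_divide power_mult_distrib)
      have "(4 * n + 4 * (real k)\<^sup>2) / t\<^sup>2 = (n + (real k)\<^sup>2) / (e\<^sup>2 / c\<^sup>2 * (real k * real (T + 1))\<^sup>2)"
        unfolding t distrib_left[symmetric] by (rule mult_divide_mult_cancel_left) simp
      then show ?thesis
        unfolding E by simp
    qed
    also have "\<dots> \<le> c\<^sup>2 / e\<^sup>2 * inverse (real (Suc T))"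
    proof (rule mult_left_mono)
      have "n + (real k)\<^sup>2 \<le> (real k)\<^sup>2 * real (T + 1)"
        using mult_right_mono[of "real k" "(real k)\<^sup>2" "real T"] k
        by (simp add: n_def power2_eq_square algebra_simps)
      then have "(n + (real k)\<^sup>2) / (real k * real (T + 1))\<^sup>2 \<le> ((real k)\<^sup>2 * real (T + 1)) / (real k * real (T + 1))\<^sup>2"
        by (intro divide_right_mono) auto
      also have "\<dots> = inverse (real (Suc T))"
        using k by (simp add: power2_eq_square divide_simps)
      finally show "(n + (real k)\<^sup>2) / (real k * real (T + 1))\<^sup>2 \<le> inverse (real (Suc T))" .
    qed auto
    finally show ?thesis .
  qed
  show "(\<lambda>T. prob {\<omega> \<in> space M. dist (est T \<omega>) c > e}) \<longlonglongrightarrow> 0"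
  proof (rule tendsto_sandwich[OF _ _ tendsto_const])
    show "\<forall>\<^sub>F T in sequentially. 0 \<le> prob {\<omega> \<in> space M. dist (est T \<omega>) c > e}"
      by simp
    show "\<forall>\<^sub>F T in sequentially. prob {\<omega> \<in> space M. dist (est T \<omega>) c > e} \<le> c\<^sup>2 / e\<^sup>2 * inverse (real (Suc T))"
      using eventually_ge_at_top[of 1] by eventually_elim (rule bound)
    show "(\<lambda>T. c\<^sup>2 / e\<^sup>2 * inverse (real (Suc T))) \<longlonglongrightarrow> 0"
      by (rule tendsto_mult_right_zero[OF LIMSEQ_inverse_real_of_nat])
  qed
qed

section \<open>Maximum likelihood\<close>

lemma ln_add_ratio_minimal:
  fixes x w :: real
  assumes "x > 0" "w > 0"
  shows "ln w + 1 \<le> ln x + w / x" and "ln w + 1 = ln x + w / x \<longleftrightarrow> x = w"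
proof -
  have pos: "w / x > 0" using assms by simp
  have ln: "ln (w / x) = ln w - ln x" using assms by (simp add: ln_div)
  show "ln w + 1 \<le> ln x + w / x"
    using ln_le_minus_one[OF pos] ln by simp
  show "ln w + 1 = ln x + w / x \<longleftrightarrow> x = w"
    using ln_eq_minus_one[OF pos] ln assms by (auto simp: field_simps)
qed

text \<open>
  Up to sign and a constant, \<open>cost\<close> is the part of twice the log-likelihood that
  involves one variance \<open>v\<close>; the excess \<open>d\<close> stems from the deviation of
  the mean parameters from the sample means.
\<close>

lemma gaussian_cost_minimal:
  fixes v w d k :: real
  assumes "v > 0" "w > 0" "k > 0" "d \<ge> 0"
  defines "cost \<equiv> \<lambda>v d. k * ln v + (k * w + d) / v"
  shows "cost w 0 \<le> cost v d" and "cost v d \<le> cost w 0 \<Longrightarrow> v = w \<and> d = 0"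
proof -
  have eq: "cost v d - cost w 0 = k * ((ln v + w / v) - (ln w + 1)) + d / v"
    using assms by (simp add: cost_def field_simps)
  have 1: "0 \<le> k * ((ln v + w / v) - (ln w + 1))"
    using ln_add_ratio_minimal(1)[OF assms(1,2)] assms(3) by simp
  have 2: "0 \<le> d / v" using assms by simp
  show "cost w 0 \<le> cost v d" using eq 1 2 by linarith
  assume "cost v d \<le> cost w 0"
  then have "k * ((ln v + w / v) - (ln w + 1)) = 0" "d / v = 0"
    using eq 1 2 by linarith+
  then show "v = w \<and> d = 0"
    using ln_add_ratio_minimal(2)[OF assms(1,2)] assms by auto
qed

lemma likelihood_pos:
  assumes "\<forall>j\<le>J. v j > 0"
  shows "likelihood T J f g m n v > 0"
  unfolding likelihood_def using assms
  by (intro prod_pos ballI mult_pos_pos ln_mvnormal_density_mat(1)) auto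

text \<open>
  Positivity of the candidate variances \<open>w\<close> is essential: without scatter the
  likelihood is unbounded as a variance tends to 0, and no maximiser exists.
\<close>

lemma is_mle_iff:
  fixes F G :: "nat \<Rightarrow> nat \<Rightarrow> 'a \<Rightarrow> real^2" and w :: "nat \<Rightarrow> real"
  assumes w: "\<And>j. j \<le> J \<Longrightarrow> w j > 0"
    and w0: "2 * real (T + 1) * w 0 = sample_scatter (\<lambda>t. F t 0) T \<omega>"
    and wj: "\<And>j. 1 \<le> j \<Longrightarrow> j \<le> J \<Longrightarrow>
      4 * real (T + 1) * w j = sample_scatter (\<lambda>t. F t j) T \<omega> + sample_scatter (\<lambda>t. G t j) T \<omega>"
  shows "is_mle T J (\<lambda>t j. F t j \<omega>) (\<lambda>t j. G t j \<omega>) m n v \<longleftrightarrow>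
    (\<forall>j\<le>J. m j = sample_mean (\<lambda>t. F t j) T \<omega>) \<and>
    (\<forall>j\<in>{1..J}. n j = sample_mean (\<lambda>t. G t j) T \<omega>) \<and>
    (\<forall>j\<le>J. v j = w j)" (is "is_mle T J ?f ?g m n v \<longleftrightarrow> ?R m n v")
proof -
  define N where "N = real (T + 1)"
  have N: "N > 0" by (simp add: N_def)
  define mF where "mF j = sample_mean (\<lambda>t. F t j) T \<omega>" for j
  define mG where "mG j = sample_mean (\<lambda>t. G t j) T \<omega>" for j
  \<comment> \<open>Each \<open>k\<close> is the number of real coordinates observed at the order, twice as many for \<open>j > 0\<close> as for \<open>j = 0\<close>.\<close>
  define k where "k j = (if j = 0 then 2 else 4) * N" for j :: nat
  define d where "d m n j = N * ((norm (mF j - m j))\<^sup>2 + (if j = 0 then 0 else (norm (mG j - n j))\<^sup>2))"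
    for m n :: "nat \<Rightarrow> real^2" and j
  define cost where "cost m n v j = k j * ln (v j) + (k j * w j + d m n j) / v j"
    for m n :: "nat \<Rightarrow> real^2" and v :: "nat \<Rightarrow> real" and j
  let ?L = "likelihood T J ?f ?g"
  have k: "k j > 0" for j using N by (simp add: k_def)
  have d: "d m n j \<ge> 0" for m n j using N by (simp add: d_def)
  have d0: "d mF mG j = 0" for j by (simp add: d_def)
  have ln_L: "2 * ln (?L m n v) = - (2 * N * real (1 + 2 * J) * ln (2 * pi)) - (\<Sum>j=0..J. cost m n v j)"
    if v: "\<forall>j\<le>J. v j > 0" for m n v
  proof -
    have c0: "cost m n v 0 = 2 * N * ln (v 0) + (\<Sum>t=0..T. (norm (?f t 0 - m 0))\<^sup>2 / v 0)"
      unfolding sum_divide_distrib[symmetric] sum_square_distance_eq_scatter[of "\<lambda>t. F t 0" \<omega> "m 0" T] w0[symmetric]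
      by (simp add: cost_def k_def d_def mF_def N_def)
    have cj: "cost m n v j = 4 * N * ln (v j)
        + (\<Sum>t=0..T. ((norm (?f t j - m j))\<^sup>2 + (norm (?g t j - n j))\<^sup>2) / v j)" if "j \<in> {1..J}" for j
    proof -
      have j: "1 \<le> j" "j \<le> J" using that by auto
      have "(\<Sum>t=0..T. (norm (?f t j - m j))\<^sup>2 + (norm (?g t j - n j))\<^sup>2) = k j * w j + d m n j"
        unfolding sum.distrib sum_square_distance_eq_scatter[of "\<lambda>t. F t j" \<omega> "m j" T]
          sum_square_distance_eq_scatter[of "\<lambda>t. G t j" \<omega> "n j" T]
        using wj[OF j] j by (simp add: k_def d_def mF_def mG_def N_def algebra_simps)
      then show ?thesis
        using j by (simp add: cost_def sum_divide_distrib[symmetric] k_def)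
    qed
    have "(\<Sum>j=1..J. cost m n v j) = (\<Sum>j=1..J. 4 * N * ln (v j))
        + (\<Sum>j=1..J. \<Sum>t=0..T. ((norm (?f t j - m j))\<^sup>2 + (norm (?g t j - n j))\<^sup>2) / v j)"
      by (simp add: cj sum.distrib)
    also have "(\<Sum>j=1..J. \<Sum>t=0..T. ((norm (?f t j - m j))\<^sup>2 + (norm (?g t j - n j))\<^sup>2) / v j)
        = (\<Sum>t=0..T. \<Sum>j=1..J. ((norm (?f t j - m j))\<^sup>2 + (norm (?g t j - n j))\<^sup>2) / v j)"
      by (rule sum.swap)
    also have "(\<Sum>j=1..J. 4 * N * ln (v j)) = 2 * N * (\<Sum>j=1..J. 2 * ln (v j))"
      by (simp add: sum_distrib_left algebra_simps)
    finally have c: "(\<Sum>j=0..J. cost m n v j)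
        = 2 * N * (ln (v 0) + (\<Sum>j=1..J. 2 * ln (v j))) + (\<Sum>t=0..T. (norm (?f t 0 - m 0))\<^sup>2 / v 0)
          + (\<Sum>t=0..T. \<Sum>j=1..J. ((norm (?f t j - m j))\<^sup>2 + (norm (?g t j - n j))\<^sup>2) / v j)"
      by (simp add: sum.atLeast_Suc_atMost c0 algebra_simps)
    have const: "(\<Sum>t=0..T. ln (v 0) + (\<Sum>j=1..J. 2 * ln (v j))) = N * (ln (v 0) + (\<Sum>j=1..J. 2 * ln (v j)))"
      by (simp add: N_def)
    show ?thesis
      unfolding ln_likelihood[OF v] c const N_def[symmetric] by (simp add: algebra_simps)
  qed
  have le_iff: "?L m n v \<le> ?L m' n' v' \<longleftrightarrow> (\<Sum>j=0..J. cost m' n' v' j) \<le> (\<Sum>j=0..J. cost m n v j)"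
    if v: "\<forall>j\<le>J. v j > 0" and v': "\<forall>j\<le>J. v' j > 0" for m n v m' n' v'
  proof -
    have "?L m n v \<le> ?L m' n' v' \<longleftrightarrow> ln (?L m n v) \<le> ln (?L m' n' v')"
      by (rule ln_le_cancel_iff[symmetric]) (rule likelihood_pos[OF v], rule likelihood_pos[OF v'])
    then show ?thesis using ln_L[OF v, of m n] ln_L[OF v', of m' n'] by linarith
  qed
  have w': "\<forall>j\<le>J. w j > 0" using w by blast
  have best: "cost mF mG w j \<le> cost m n v j" if "v j > 0" "j \<le> J" for m n v j
    using gaussian_cost_minimal(1)[OF that(1) w[OF that(2)] k d] by (simp add: cost_def d0)
  have unique: "v j = w j \<and> d m n j = 0" if "cost m n v j \<le> cost mF mG w j" "v j > 0" "j \<le> J" for m n v j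
    using gaussian_cost_minimal(2)[OF that(2) w[OF that(3)] k d] that(1) by (simp add: cost_def d0)
  have d_zero: "d m n j = 0 \<longleftrightarrow> m j = mF j \<and> (j \<noteq> 0 \<longrightarrow> n j = mG j)" for m n j
  proof -
    have "d m n j = 0 \<longleftrightarrow> (norm (mF j - m j))\<^sup>2 + (if j = 0 then 0 else (norm (mG j - n j))\<^sup>2) = 0"
      using N by (simp add: d_def)
    also have "\<dots> \<longleftrightarrow> m j = mF j \<and> (j \<noteq> 0 \<longrightarrow> n j = mG j)"
      by (auto simp: add_nonneg_eq_0_iff)
    finally show ?thesis .
  qed
  have R: "?R m n v \<longleftrightarrow> (\<forall>j\<le>J. v j = w j \<and> d m n j = 0)"
    unfolding d_zero mF_def[symmetric] mG_def[symmetric]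
    by (auto simp: Suc_le_eq)
  show ?thesis
    unfolding R
  proof
    assume mle: "is_mle T J ?f ?g m n v"
    then have v: "\<forall>j\<le>J. v j > 0" and "?L mF mG w \<le> ?L m n v"
      using w' by (auto simp: is_mle_def)
    then have le: "(\<Sum>j=0..J. cost m n v j) \<le> (\<Sum>j=0..J. cost mF mG w j)"
      by (simp add: le_iff[OF w' v])
    have eq: "cost mF mG w j = cost m n v j" if "j \<le> J" for j
    proof (rule ccontr)
      assume "cost mF mG w j \<noteq> cost m n v j"
      then have "cost mF mG w j < cost m n v j" using best[of v j m n] v that by auto
      then have "(\<Sum>j=0..J. cost mF mG w j) < (\<Sum>j=0..J. cost m n v j)"
        using that best v by (intro sum_strict_mono_ex1) auto
      then show False using le by simp
    qed
    show "\<forall>j\<le>J. v j = w j \<and> d m n j = 0"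
    proof (intro allI impI)
      fix j assume j: "j \<le> J"
      then have "cost m n v j \<le> cost mF mG w j" using eq by simp
      then show "v j = w j \<and> d m n j = 0"
        using v j by (intro unique) auto
    qed
  next
    assume R': "\<forall>j\<le>J. v j = w j \<and> d m n j = 0"
    then have v: "\<forall>j\<le>J. v j > 0" using w by auto
    have eq: "(\<Sum>j=0..J. cost m n v j) = (\<Sum>j=0..J. cost mF mG w j)"
      using R' by (intro sum.cong refl) (simp add: cost_def d0)
    show "is_mle T J ?f ?g m n v"
      unfolding is_mle_def
    proof (intro conjI allI impI)
      fix m' n' v' assume v': "\<forall>j\<le>J. 0 < (v' j :: real)"
      show "?L m' n' v' \<le> ?L m n v"
        unfolding le_iff[OF v' v] eq using v' by (intro sum_mono best) auto
    qed (use v in blast)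
  qed
qed

section \<open>Independent families\<close>

text \<open>
  Functions of disjoint blocks of an independent family are independent. All regroupings of the
  coefficients (into vectors, into samples in \<open>t\<close>, and into statistics of whole
  samples) are instances.
\<close>

lemma (in prob_space) indep_vars_group:
  assumes X: "indep_vars (\<lambda>_. N) X UNIV" and K: "disjoint_family_on K L"
    and g: "\<And>l. l \<in> L \<Longrightarrow> g l \<in> PiM (K l) (\<lambda>_. N) \<rightarrow>\<^sub>M N' l"
    and Y: "\<And>l \<omega>. l \<in> L \<Longrightarrow> Y l \<omega> = g l (restrict (\<lambda>i. X i \<omega>) (K l))"
  shows "indep_vars N' Y L"
proof -
  have "indep_vars N' (\<lambda>l \<omega>. g l (restrict (\<lambda>i. X i \<omega>) (K l))) L"
    by (rule indep_vars_compose2[OF indep_vars_restrict[OF X _ K] g]) auto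
  then show ?thesis
    by (rule indep_vars_cong[THEN iffD1, rotated -1]) (auto simp: Y)
qed

lemma (in prob_space) indep_vars_imp_indep_var:
  assumes X: "indep_vars (\<lambda>_. N) X I" and ij: "i \<in> I" "j \<in> I" "i \<noteq> j"
  shows "indep_var N (X i) N (X j)"
proof -
  have "indep_pair (PiM {i} (\<lambda>_. N)) (\<lambda>\<omega>. restrict (\<lambda>k. X k \<omega>) {i}) (PiM {j} (\<lambda>_. N)) (\<lambda>\<omega>. restrict (\<lambda>k. X k \<omega>) {j})"
    unfolding indep_pair_iff_indep_var using ij by (intro indep_var_restrict[OF X]) auto
  from indep_pair_compose[OF this, of "\<lambda>f. f i" N "\<lambda>f. f j" N] show ?thesis
    by (simp add: indep_pair_iff_indep_var)
qed

lemma (in prob_space) indep_vars_cong_AE: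
  assumes X: "indep_vars N X I" and Y: "\<And>i. i \<in> I \<Longrightarrow> Y i \<in> measurable M (N i)"
    and eq: "\<And>i. i \<in> I \<Longrightarrow> AE \<omega> in M. X i \<omega> = Y i \<omega>"
  shows "indep_vars N Y I"
  unfolding indep_vars_def2
proof (intro conjI ballI Y indep_setsI)
  have X_meas: "X i \<in> measurable M (N i)" if "i \<in> I" for i
    using X that by (simp add: indep_vars_def2)
  show "{Y i -` A \<inter> space M |A. A \<in> sets (N i)} \<subseteq> events" if "i \<in> I" for i
    using measurable_sets[OF Y[OF that]] by auto
  fix A J assume J: "J \<noteq> {}" "J \<subseteq> I" "finite J"
    and A: "\<forall>j\<in>J. A j \<in> {Y j -` B \<inter> space M |B. B \<in> sets (N j)}"
  then obtain B where B: "\<And>j. j \<in> J \<Longrightarrow> A j = Y j -` B j \<inter> space M" "\<And>j. j \<in> J \<Longrightarrow> B j \<in> sets (N j)"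
    by (simp, metis)
  have XB: "X j -` B j \<inter> space M \<in> events" "Y j -` B j \<inter> space M \<in> events" if "j \<in> J" for j
    using that J(2) B(2) by (auto intro!: measurable_sets[OF X_meas] measurable_sets[OF Y])
  have one: "prob (X j -` B j \<inter> space M) = prob (A j)" if "j \<in> J" for j
  proof (rule finite_measure_eq_AE)
    show "AE \<omega> in M. \<omega> \<in> X j -` B j \<inter> space M \<longleftrightarrow> \<omega> \<in> A j"
      using eq[OF subsetD[OF J(2) that]] by eventually_elim (auto simp: B(1)[OF that])
  qed (use XB[OF that] B(1)[OF that] in auto)
  have "AE \<omega> in M. \<forall>j\<in>J. X j \<omega> = Y j \<omega>"
    using eq J by (intro AE_finite_allI) auto
  then have "AE \<omega> in M. \<omega> \<in> (\<Inter>j\<in>J. A j) \<longleftrightarrow> \<omega> \<in> (\<Inter>j\<in>J. X j -` B j \<inter> space M)"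
    by eventually_elim (auto simp: B(1))
  then have "prob (\<Inter>j\<in>J. A j) = prob (\<Inter>j\<in>J. X j -` B j \<inter> space M)"
    using XB B(1) J by (intro finite_measure_eq_AE sets.finite_INT) auto
  also have "\<dots> = (\<Prod>j\<in>J. prob (X j -` B j \<inter> space M))"
    using J B(2) by (intro indep_varsD[OF X]) auto
  also have "\<dots> = (\<Prod>j\<in>J. prob (A j))"
    by (intro prod.cong refl one)
  finally show "prob (\<Inter>j\<in>J. A j) = (\<Prod>j\<in>J. prob (A j))" .
qed

lemma distributed_cong_AE:
  assumes X: "distributed M lborel X f" and Y: "Y \<in> borel_measurable M" and eq: "AE \<omega> in M. X \<omega> = Y \<omega>"
  shows "distributed M lborel Y f"
proof -
  have "distr M lborel X = distr M lborel Y"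
    using distributed_borel_measurable_lborel[OF X] Y by (intro distr_cong_AE refl eq) auto
  then show ?thesis
    using X Y by (simp add: distributed_def)
qed

section \<open>Fourier coefficients of the noise\<close>

lemma (in prob_space) normal_nn_second_moment:
  assumes X: "distributed M lborel X (normal_density 0 s)" and s: "s > 0"
  shows "(\<integral>\<^sup>+\<omega>. ennreal ((X \<omega>)\<^sup>2) \<partial>M) = ennreal (s\<^sup>2)"
proof -
  have "has_bochner_integral lborel (\<lambda>x. normal_density 0 s x * x\<^sup>2) (s\<^sup>2)"
    using normal_moment_even[OF s, of 0 1] by (simp add: fact_numeral)
  then have "(\<integral>\<^sup>+x. ennreal (normal_density 0 s x * x\<^sup>2) \<partial>lborel) = ennreal (s\<^sup>2)"
    by (subst nn_integral_eq_integral) (auto simp: has_bochner_integral_iff)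
  then show ?thesis
    using distributed_nn_integral[OF X, of "\<lambda>x. ennreal (x\<^sup>2)"] by (simp add: ennreal_mult')
qed

text \<open>
  Split \<open>\<bar>a\<bar> \<le> r * a\<^sup>2 + 1 / r\<close> with the weight \<open>r = j powr
  (1 + \<epsilon>)\<close>: the inverse weights are summable, and the weighted squares have a
  finite total expectation by the assumption on the variances.
\<close>

lemma (in prob_space) AE_summable_gaussian_sequence:
  fixes a :: "nat \<Rightarrow> 'a \<Rightarrow> real"
  assumes a: "\<And>j. distributed M lborel (a j) (normal_density 0 (\<sigma> j))" and \<sigma>: "\<And>j. \<sigma> j > 0"
    and \<epsilon>: "\<epsilon> > 0" "summable (\<lambda>j. real j powr (2 + \<epsilon>) * (\<sigma> j)\<^sup>2)"
  shows "AE \<omega> in M. summable (\<lambda>j. \<bar>a j \<omega>\<bar>)"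
proof -
  note [measurable] = distributed_borel_measurable_lborel[OF a]
  \<comment> \<open>The exponent leaves room on both sides: \<open>p > 1\<close> makes \<open>j powr - p\<close> summable, and \<open>p \<le> 2 + \<epsilon>\<close>.\<close>
  define p where "p = 1 + \<epsilon>"
  have p: "p > 1" using \<epsilon> by (simp add: p_def)
  have "summable (\<lambda>j. real j powr p * (\<sigma> j)\<^sup>2)"
  proof (rule summable_comparison_test'[OF \<epsilon>(2), of 1])
    fix j :: nat assume "j \<ge> 1"
    then have "real j powr p \<le> real j powr (2 + \<epsilon>)"
      by (intro powr_mono) (auto simp: p_def)
    then show "norm (real j powr p * (\<sigma> j)\<^sup>2) \<le> real j powr (2 + \<epsilon>) * (\<sigma> j)\<^sup>2"
      by (auto intro: mult_right_mono)
  qed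
  then have "(\<Sum>j. ennreal (real j powr p * (\<sigma> j)\<^sup>2)) < \<infinity>"
    by (subst suminf_ennreal2) auto
  also have "(\<Sum>j. ennreal (real j powr p * (\<sigma> j)\<^sup>2)) = (\<Sum>j. \<integral>\<^sup>+\<omega>. ennreal (real j powr p * (a j \<omega>)\<^sup>2) \<partial>M)"
    by (simp add: ennreal_mult nn_integral_cmult normal_nn_second_moment[OF a \<sigma>])
  also have "\<dots> = (\<integral>\<^sup>+\<omega>. (\<Sum>j. ennreal (real j powr p * (a j \<omega>)\<^sup>2)) \<partial>M)"
    by (rule nn_integral_suminf[symmetric]) measurable
  finally have "AE \<omega> in M. (\<Sum>j. ennreal (real j powr p * (a j \<omega>)\<^sup>2)) \<noteq> \<infinity>"
    by (intro nn_integral_PInf_AE) auto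
  then show ?thesis
  proof eventually_elim
    case (elim \<omega>)
    then have "summable (\<lambda>j. real j powr p * (a j \<omega>)\<^sup>2)"
      by (intro summable_suminf_not_top) (auto simp: top_unique)
    moreover have "summable (\<lambda>j. real j powr - p)"
      using p by (simp add: summable_real_powr_iff)
    ultimately have sm: "summable (\<lambda>j. real j powr p * (a j \<omega>)\<^sup>2 + real j powr - p)"
      by (rule summable_add)
    show ?case
    proof (rule summable_comparison_test'[OF sm, of 1])
      fix j :: nat assume j: "j \<ge> 1"
      define r where "r = real j powr p"
      have r: "r > 0" "real j powr - p = 1 / r"
        using j by (auto simp: r_def powr_minus_divide)
      have "\<bar>a j \<omega>\<bar> \<le> r * (a j \<omega>)\<^sup>2 + 1 / r"
      proof (cases "\<bar>a j \<omega>\<bar> \<le> 1 / r")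
        case True
        then show ?thesis using r by (smt (verit) mult_nonneg_nonneg zero_le_power2)
      next
        case False
        then have "1 \<le> r * \<bar>a j \<omega>\<bar>" using r by (simp add: field_simps)
        then have "1 * \<bar>a j \<omega>\<bar> \<le> (r * \<bar>a j \<omega>\<bar>) * \<bar>a j \<omega>\<bar>"
          by (intro mult_right_mono) auto
        then have "\<bar>a j \<omega>\<bar> \<le> r * (a j \<omega>)\<^sup>2"
          by (simp add: power2_eq_square mult.assoc)
        then show ?thesis using r(1) by (smt (verit) divide_nonneg_pos)
      qed
      then show "norm \<bar>a j \<omega>\<bar> \<le> real j powr p * (a j \<omega>)\<^sup>2 + real j powr - p"
        by (simp add: r_def[symmetric] r(2))
    qed
  qed
qed

text \<open>
  Continuity of the paths makes the process jointly measurable in \<open>\<omega>\<close> and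
  \<open>\<theta>\<close>, as a limit of processes that are constant on the cells of a grid; then
  the integral over \<open>\<theta>\<close> is measurable.
\<close>

lemma borel_measurable_integral_continuous_paths:
  fixes f :: "real \<Rightarrow> 'a \<Rightarrow> 'b::euclidean_space"
  assumes f: "\<And>\<theta>. \<theta> \<in> {a..b} \<Longrightarrow> f \<theta> \<in> borel_measurable M"
    and cont: "\<And>\<omega>. \<omega> \<in> space M \<Longrightarrow> continuous_on {a..b} (\<lambda>\<theta>. f \<theta> \<omega>)"
    and ab: "a \<le> b"
  shows "(\<lambda>\<omega>. integral {a..b} (\<lambda>\<theta>. f \<theta> \<omega>)) \<in> borel_measurable M"
proof -
  \<comment> \<open>Grid points are clamped to the interval, as the process is measurable there only.\<close>
  define cell where "cell n i = max a (min b (real_of_int i / real (Suc n)))" for n i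
  define q where "q n \<theta> = cell n \<lfloor>real (Suc n) * \<theta>\<rfloor>" for n \<theta>
  have cell: "cell n i \<in> {a..b}" for n i
    using ab by (auto simp: cell_def)
  have q_lim: "(\<lambda>n. q n \<theta>) \<longlonglongrightarrow> \<theta>" if \<theta>: "\<theta> \<in> {a..b}" for \<theta>
  proof -
    have "(\<lambda>n. real_of_int \<lfloor>real (Suc n) * \<theta>\<rfloor> / real (Suc n)) \<longlonglongrightarrow> \<theta>"
    proof (rule tendsto_sandwich)
      show "(\<lambda>n. \<theta> - inverse (real (Suc n))) \<longlonglongrightarrow> \<theta>"
        using tendsto_diff[OF tendsto_const[of \<theta>] LIMSEQ_inverse_real_of_nat] by simp
      have "\<theta> - inverse (real (Suc n)) \<le> real_of_int \<lfloor>real (Suc n) * \<theta>\<rfloor> / real (Suc n)"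
        "real_of_int \<lfloor>real (Suc n) * \<theta>\<rfloor> / real (Suc n) \<le> \<theta>" for n
      proof -
        define r where "r = real (Suc n)"
        have r: "r > 0" by (simp add: r_def)
        have "r * \<theta> - 1 \<le> real_of_int \<lfloor>r * \<theta>\<rfloor>" "real_of_int \<lfloor>r * \<theta>\<rfloor> \<le> r * \<theta>"
          by linarith+
        from divide_right_mono[OF this(1), of r] divide_right_mono[OF this(2), of r] r
        have "\<theta> - inverse r \<le> real_of_int \<lfloor>r * \<theta>\<rfloor> / r" "real_of_int \<lfloor>r * \<theta>\<rfloor> / r \<le> \<theta>"
          by (simp_all add: diff_divide_distrib inverse_eq_divide)
        then show "\<theta> - inverse (real (Suc n)) \<le> real_of_int \<lfloor>real (Suc n) * \<theta>\<rfloor> / real (Suc n)"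
          "real_of_int \<lfloor>real (Suc n) * \<theta>\<rfloor> / real (Suc n) \<le> \<theta>"
          by (simp_all only: r_def)
      qed
      then show "\<forall>\<^sub>F n in sequentially. \<theta> - inverse (real (Suc n)) \<le> real_of_int \<lfloor>real (Suc n) * \<theta>\<rfloor> / real (Suc n)"
        "\<forall>\<^sub>F n in sequentially. real_of_int \<lfloor>real (Suc n) * \<theta>\<rfloor> / real (Suc n) \<le> \<theta>"
        by (auto intro!: always_eventually)
    qed simp
    then have "(\<lambda>n. q n \<theta>) \<longlonglongrightarrow> max a (min b \<theta>)"
      unfolding q_def cell_def by (intro tendsto_max tendsto_min tendsto_const)
    then show ?thesis using \<theta> by simp
  qed
  let ?H = "\<lambda>(\<omega>, \<theta>). indicator {a..b} \<theta> *\<^sub>R f \<theta> \<omega>"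
  have "?H \<in> borel_measurable (M \<Otimes>\<^sub>M lborel)"
  proof (rule borel_measurable_LIMSEQ_metric)
    fix n
    have "(\<lambda>p. f (cell n i) (fst p)) \<in> borel_measurable (M \<Otimes>\<^sub>M (lborel :: real measure))" for i
      by (rule measurable_compose[OF measurable_fst f[OF cell]])
    moreover have "(\<lambda>p. \<lfloor>real (Suc n) * snd p\<rfloor>) \<in> M \<Otimes>\<^sub>M lborel \<rightarrow>\<^sub>M count_space UNIV"
      by measurable
    ultimately have "(\<lambda>p. f (q n (snd p)) (fst p)) \<in> borel_measurable (M \<Otimes>\<^sub>M lborel)"
      unfolding q_def by (rule measurable_compose_countable)
    then show "(\<lambda>p. indicator {a..b} (snd p) *\<^sub>R f (q n (snd p)) (fst p)) \<in> borel_measurable (M \<Otimes>\<^sub>M lborel)"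
      by measurable
  next
    fix p assume "p \<in> space (M \<Otimes>\<^sub>M (lborel :: real measure))"
    then obtain \<omega> \<theta> where p: "p = (\<omega>, \<theta>)" and \<omega>: "\<omega> \<in> space M"
      by (cases p) (auto simp: space_pair_measure)
    show "(\<lambda>n. indicator {a..b} (snd p) *\<^sub>R f (q n (snd p)) (fst p)) \<longlonglongrightarrow> ?H p"
    proof (cases "\<theta> \<in> {a..b}")
      case True
      have "q n \<theta> \<in> {a..b}" for n
        unfolding q_def by (rule cell)
      then have "(\<lambda>n. f (q n \<theta>) \<omega>) \<longlonglongrightarrow> f \<theta> \<omega>"
        by (intro continuous_on_tendsto_compose[OF cont[OF \<omega>] q_lim[OF True] True] always_eventually) simp
      then show ?thesis using True by (simp add: p)
    qed (simp add: p)
  qed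
  then have "(\<lambda>\<omega>. \<integral>\<theta>. indicator {a..b} \<theta> *\<^sub>R f \<theta> \<omega> \<partial>lborel) \<in> borel_measurable M"
    by (rule lborel.borel_measurable_lebesgue_integral)
  moreover have "(\<integral>\<theta>. indicator {a..b} \<theta> *\<^sub>R f \<theta> \<omega> \<partial>lborel) = integral {a..b} (\<lambda>\<theta>. f \<theta> \<omega>)" if "\<omega> \<in> space M" for \<omega>
    using set_borel_integral_eq_integral(2)[OF borel_integrable_atLeastAtMost'[OF cont[OF that]]]
    by (simp add: set_lebesgue_integral_def)
  ultimately show ?thesis
    by (subst measurable_cong[where g = "\<lambda>\<omega>. \<integral>\<theta>. indicator {a..b} \<theta> *\<^sub>R f \<theta> \<omega> \<partial>lborel"]) auto
qed

lemma borel_measurable_fourier_coefficients: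
  assumes "\<And>\<theta>. \<theta> \<in> {-pi..pi} \<Longrightarrow> N \<theta> \<in> borel_measurable M"
    and cont: "\<And>\<omega>. \<omega> \<in> space M \<Longrightarrow> continuous_on {-pi..pi} (\<lambda>\<theta>. N \<theta> \<omega>)"
  shows "(\<lambda>\<omega>. fourier_cos (\<lambda>\<theta>. N \<theta> \<omega>) j) \<in> borel_measurable M"
    and "(\<lambda>\<omega>. fourier_sin (\<lambda>\<theta>. N \<theta> \<omega>) j) \<in> borel_measurable M"
proof -
  have trig: "continuous_on {-pi..pi} (\<lambda>\<theta>. cos (real j * \<theta>))" "continuous_on {-pi..pi} (\<lambda>\<theta>. sin (real j * \<theta>))"
    by (intro continuous_intros)+
  have "(\<lambda>\<omega>. integral {-pi..pi} (\<lambda>\<theta>. w \<theta> *\<^sub>R N \<theta> \<omega>)) \<in> borel_measurable M"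
    if "continuous_on {-pi..pi} w" for w :: "real \<Rightarrow> real"
    by (rule borel_measurable_integral_continuous_paths)
       (auto intro!: borel_measurable_scaleR assms continuous_on_scaleR that)
  note int = this[OF trig(1)] this[OF trig(2)]
  show "(\<lambda>\<omega>. fourier_cos (\<lambda>\<theta>. N \<theta> \<omega>) j) \<in> borel_measurable M"
    and "(\<lambda>\<omega>. fourier_sin (\<lambda>\<theta>. N \<theta> \<omega>) j) \<in> borel_measurable M"
    unfolding fourier_cos_def fourier_sin_def by (intro borel_measurable_scaleR borel_measurable_const int)+
qed

lemma (in prob_space) AE_fourier_coefficients_noise:
  fixes a b :: "nat \<Rightarrow> 2 \<Rightarrow> 'a \<Rightarrow> real" and N :: "real \<Rightarrow> 'a \<Rightarrow> real^2"
  assumes a: "\<And>j i. distributed M lborel (a j i) (normal_density 0 (\<sigma> j))"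
    and b: "\<And>j i. distributed M lborel (b j i) (normal_density 0 (\<sigma> j))"
    and \<sigma>: "\<And>j. \<sigma> j > 0" "\<epsilon> > 0" "summable (\<lambda>j. real j powr (2 + \<epsilon>) * (\<sigma> j)\<^sup>2)"
    and series: "\<And>\<theta> i. \<theta> \<in> {-pi..pi} \<Longrightarrow>
      AE \<omega> in M. (\<lambda>j. a j i \<omega> * cos (real j * \<theta>) + b j i \<omega> * sin (real j * \<theta>)) sums (N \<theta> \<omega> $ i)"
    and cont: "\<And>\<omega>. \<omega> \<in> space M \<Longrightarrow> continuous_on {-pi..pi} (\<lambda>\<theta>. N \<theta> \<omega>)"
  shows "AE \<omega> in M. \<forall>j. fourier_cos (\<lambda>\<theta>. N \<theta> \<omega>) j = vector [a j 1 \<omega>, a j 2 \<omega>] \<and>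
    (j \<ge> 1 \<longrightarrow> fourier_sin (\<lambda>\<theta>. N \<theta> \<omega>) j = vector [b j 1 \<omega>, b j 2 \<omega>])"
proof -
  have "AE \<omega> in M. \<forall>i. summable (\<lambda>j. \<bar>a j i \<omega>\<bar>)" "AE \<omega> in M. \<forall>i. summable (\<lambda>j. \<bar>b j i \<omega>\<bar>)"
    using AE_summable_gaussian_sequence[OF a \<sigma>] AE_summable_gaussian_sequence[OF b \<sigma>]
    by (auto simp: AE_all_countable)
  moreover have "AE \<omega> in M. \<forall>\<theta>\<in>{-pi..pi} \<inter> \<rat>. \<forall>i.
      (\<lambda>j. a j i \<omega> * cos (real j * \<theta>) + b j i \<omega> * sin (real j * \<theta>)) sums (N \<theta> \<omega> $ i)"
    using series by (subst AE_ball_countable) (auto simp: countable_rat AE_all_countable)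
  ultimately show ?thesis
    using AE_space
  proof eventually_elim
    case (elim \<omega>)
    have eq: "(\<chi> i. h i) = (vector [h 1, h 2] :: real^2)" for h
      by (simp add: vec_eq_iff forall_2)
    show ?case
      using fourier_coefficients_trig_series[OF cont[OF elim(4)],
          where a = "\<lambda>j i. a j i \<omega>" and b = "\<lambda>j i. b j i \<omega>"] elim(1-3)
      by (simp add: eq)
  qed
qed

section \<open>Estimators in the noisy curve model\<close>

theorem lemma1:
  fixes M :: "'a measure"
    and \<Gamma> :: "real \<Rightarrow> real^2"
    and \<sigma> :: "nat \<Rightarrow> real"
    and A B :: "nat \<Rightarrow> nat \<Rightarrow> 2 \<Rightarrow> 'a \<Rightarrow> real"
    and N X :: "nat \<Rightarrow> real \<Rightarrow> 'a \<Rightarrow> real^2"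
    and \<mu> \<nu> :: "nat \<Rightarrow> real^2"
    and F G :: "nat \<Rightarrow> nat \<Rightarrow> 'a \<Rightarrow> real^2"
    and mu_hat nu_hat :: "nat \<Rightarrow> nat \<Rightarrow> 'a \<Rightarrow> real^2"
    and var_hat :: "nat \<Rightarrow> nat \<Rightarrow> 'a \<Rightarrow> real"
    and T :: nat
  assumes "prob_space M"
    and "C1_within \<Gamma> {-pi..pi}" and "\<Gamma> (-pi) = \<Gamma> pi"
    and "\<And>j. \<mu> j = fourier_cos \<Gamma> j"
    and "\<And>j. j \<ge> 1 \<Longrightarrow> \<nu> j = fourier_sin \<Gamma> j"
    and "\<And>j. \<sigma> j > 0"
    and "\<exists>\<epsilon>>0. summable (\<lambda>j. real j powr (2 + \<epsilon>) * (\<sigma> j)\<^sup>2)"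
    and "\<And>t j i. distributed M lborel (A t j i) (normal_density 0 (\<sigma> j))"
    and "\<And>t j i. distributed M lborel (B t j i) (normal_density 0 (\<sigma> j))"
    and "prob_space.indep_vars M (\<lambda>_. borel)
           (case_sum (\<lambda>(t, j, i). A t j i) (\<lambda>(t, j, i). B t j i)) UNIV"
    and "\<And>t \<theta>. \<theta> \<in> {-pi..pi} \<Longrightarrow> N t \<theta> \<in> borel_measurable M"
    and "\<And>t \<theta> i. \<theta> \<in> {-pi..pi} \<Longrightarrow>
           AE \<omega> in M. (\<lambda>j. A t j i \<omega> * cos (real j * \<theta>) + B t j i \<omega> * sin (real j * \<theta>))
                       sums (N t \<theta> \<omega> $ i)"
    and "\<And>t \<omega>. \<omega> \<in> space M \<Longrightarrow> C1_within (\<lambda>\<theta>. N t \<theta> \<omega>) {-pi..pi}"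
    and "\<And>t \<theta> \<omega>. X t \<theta> \<omega> = \<Gamma> \<theta> + N t \<theta> \<omega>"
    and "\<And>t j \<omega>. F t j \<omega> = fourier_cos (\<lambda>\<theta>. X t \<theta> \<omega>) j"
    and "\<And>t j \<omega>. j \<ge> 1 \<Longrightarrow> G t j \<omega> = fourier_sin (\<lambda>\<theta>. X t \<theta> \<omega>) j"
    and "\<And>T j \<omega>. mu_hat T j \<omega> = (1 / real (T + 1)) *\<^sub>R (\<Sum>t=0..T. F t j \<omega>)"
    and "\<And>T j \<omega>. j \<ge> 1 \<Longrightarrow> nu_hat T j \<omega> = (1 / real (T + 1)) *\<^sub>R (\<Sum>t=0..T. G t j \<omega>)"
    and "\<And>T j \<omega>. j \<ge> 1 \<Longrightarrow> var_hat T j \<omega> =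
           1 / (4 * real (T + 1)) *
             (\<Sum>t=0..T. (norm (F t j \<omega> - mu_hat T j \<omega>))\<^sup>2 + (norm (G t j \<omega> - nu_hat T j \<omega>))\<^sup>2)"
    and "\<And>T \<omega>. var_hat T 0 \<omega> =
           1 / (2 * real (T + 1)) * (\<Sum>t=0..T. (norm (F t 0 \<omega> - mu_hat T 0 \<omega>))\<^sup>2)"
    and "T \<ge> 1"
  shows
    \<comment> \<open>maximum likelihood, for all parts: almost surely, for every cut-off order, the
        estimators are the unique maximum likelihood estimates\<close>
    "(AE \<omega> in M. \<forall>J\<ge>1. \<forall>m n v.
        is_mle T J (\<lambda>t j. F t j \<omega>) (\<lambda>t j. G t j \<omega>) m n v \<longleftrightarrow>
          (\<forall>j\<le>J. m j = mu_hat T j \<omega>) \<and>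
          (\<forall>j\<in>{1..J}. n j = nu_hat T j \<omega>) \<and>
          (\<forall>j\<le>J. v j = var_hat T j \<omega>))
     \<and>
     \<comment> \<open>(1)\<close>
     prob_space.indep_vars M (\<lambda>_. borel) (case_sum (mu_hat T) (nu_hat T)) (UNIV <+> {1..}) \<and>
     (\<forall>j. prob_space.consistent_estimator M (\<lambda>T. mu_hat T j) (\<mu> j)) \<and>
     (\<forall>j\<ge>1. prob_space.consistent_estimator M (\<lambda>T. nu_hat T j) (\<nu> j)) \<and>
     (\<forall>j. distributed M lborel (mu_hat T j)
            (mvnormal_density (\<mu> j) (mat ((\<sigma> j)\<^sup>2 / real (T + 1))))) \<and>
     (\<forall>j\<ge>1. distributed M lborel (nu_hat T j)
            (mvnormal_density (\<nu> j) (mat ((\<sigma> j)\<^sup>2 / real (T + 1)))))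
     \<and>
     \<comment> \<open>(2)\<close>
     (\<forall>j\<ge>1. prob_space.consistent_estimator M (\<lambda>T. var_hat T j) ((\<sigma> j)\<^sup>2) \<and>
        distributed M lborel (\<lambda>\<omega>. 4 * real (T + 1) * var_hat T j \<omega> / (\<sigma> j)\<^sup>2)
          (chi_square_density (4 * T)))
     \<and>
     \<comment> \<open>(3)\<close>
     prob_space.consistent_estimator M (\<lambda>T. var_hat T 0) ((\<sigma> 0)\<^sup>2) \<and>
     distributed M lborel (\<lambda>\<omega>. 2 * real (T + 1) * var_hat T 0 \<omega> / (\<sigma> 0)\<^sup>2)
       (chi_square_density (2 * T))"
proof -
  interpret prob_space M by fact
  note \<mu> = assms(4) and \<nu> = assms(5) and \<sigma>_pos = assms(6) and A = assms(8) and B = assms(9)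
    and indep = assms(10) and N_meas = assms(11) and series = assms(12) and X = assms(14)
    and F = assms(15) and G = assms(16) and mu_hat = assms(17) and nu_hat = assms(18)
    and var_hat = assms(19) and var_hat0 = assms(20) and T = assms(21)
  obtain \<epsilon> where \<epsilon>: "\<epsilon> > 0" "summable (\<lambda>j. real j powr (2 + \<epsilon>) * (\<sigma> j)\<^sup>2)"
    using assms(7) by auto
  have \<Gamma>_cont: "continuous_on {-pi..pi} \<Gamma>"
    by (rule C1_within_imp_continuous_on) fact
  have N_cont: "continuous_on {-pi..pi} (\<lambda>\<theta>. N t \<theta> \<omega>)" if "\<omega> \<in> space M" for t \<omega>
    by (rule C1_within_imp_continuous_on) (rule assms(13)[OF that])

  \<comment> \<open>One index set for all coefficients: a pair \<open>(t, j)\<close> on the left stands for a cosine, on the right for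
     a sine coefficient. A label \<open>l\<close> is the order \<open>j\<close> with the same convention, and \<open>Z l\<close> is the sample in \<open>t\<close>
     of the noise vectors with label \<open>l\<close>. The labels in \<open>I\<close> omit the sine coefficient of order 0, for which \<open>G\<close>
     and \<open>nu_hat\<close> are unspecified.\<close>
  define W :: "(nat \<times> nat) + (nat \<times> nat) \<Rightarrow> 'a \<Rightarrow> real^2" where
    "W = case_sum (\<lambda>(t, j) \<omega>. vector [A t j 1 \<omega>, A t j 2 \<omega>]) (\<lambda>(t, j) \<omega>. vector [B t j 1 \<omega>, B t j 2 \<omega>])"
  define emb :: "nat + nat \<Rightarrow> nat \<Rightarrow> (nat \<times> nat) + (nat \<times> nat)" where
    "emb l t = map_sum (Pair t) (Pair t) l" for l t
  have emb_eq_iff: "emb l t = emb l' t' \<longleftrightarrow> l = l' \<and> t = t'" for l l' t t'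
    by (cases l; cases l') (auto simp: emb_def)
  define Z where "Z l t = W (emb l t)" for l t
  define H where "H l t = case_sum (F t) (G t) l" for l t
  define ord :: "nat + nat \<Rightarrow> nat" where "ord l = case_sum id id l" for l
  define coef where "coef l = case_sum \<mu> \<nu> l" for l
  define I :: "(nat + nat) set" where "I = UNIV <+> {1..}"

  have W_ind: "indep_vars (\<lambda>_. borel) W UNIV"
  proof (rule indep_vars_group[OF indep])
    let ?K = "case_sum (\<lambda>(t, j). {Inl (t, j, 1), Inl (t, j, 2)}) (\<lambda>(t, j). {Inr (t, j, 1), Inr (t, j, 2)})
      :: _ \<Rightarrow> ((nat \<times> nat \<times> 2) + (nat \<times> nat \<times> 2)) set"
    let ?g = "case_sum (\<lambda>(t, j) f. vector [f (Inl (t, j, 1)), f (Inl (t, j, 2))])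
      (\<lambda>(t, j) f. vector [f (Inr (t, j, 1)), f (Inr (t, j, 2))]) :: _ \<Rightarrow> (_ \<Rightarrow> real) \<Rightarrow> real^2"
    show "disjoint_family_on ?K UNIV"
      by (auto simp: disjoint_family_on_def split: sum.splits)
    show "?g l \<in> PiM (?K l) (\<lambda>_. borel) \<rightarrow>\<^sub>M borel" for l
      by (auto split: sum.splits intro!: measurable_vec2)
    show "W l \<omega> = ?g l (restrict (\<lambda>i. case_sum (\<lambda>(t, j, i). A t j i) (\<lambda>(t, j, i). B t j i) i \<omega>) (?K l))" for l \<omega>
      by (auto simp: W_def split: sum.splits)
  qed
  have Z_distr: "distributed M lborel (Z l t) (mvnormal_density 0 (mat ((\<sigma> (ord l))\<^sup>2)))" for l t
  proof -
    have "distributed M lborel (Z (Inl j) t) (mvnormal_density 0 (mat ((\<sigma> j)\<^sup>2)))" for j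
    proof -
      have "indep_var borel (A t j 1) borel (A t j 2)"
        using indep_vars_imp_indep_var[OF indep, of "Inl (t, j, 1)" "Inl (t, j, 2)"] by simp
      from distributed_vec2_normal[OF \<sigma>_pos this A A] show ?thesis
        by (simp add: Z_def W_def emb_def)
    qed
    moreover have "distributed M lborel (Z (Inr j) t) (mvnormal_density 0 (mat ((\<sigma> j)\<^sup>2)))" for j
    proof -
      have "indep_var borel (B t j 1) borel (B t j 2)"
        using indep_vars_imp_indep_var[OF indep, of "Inr (t, j, 1)" "Inr (t, j, 2)"] by simp
      from distributed_vec2_normal[OF \<sigma>_pos this B B] show ?thesis
        by (simp add: Z_def W_def emb_def)
    qed
    ultimately show ?thesis by (cases l) (auto simp: ord_def)
  qed
  have Z_meas [measurable]: "Z l t \<in> borel_measurable M" for l t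
    by (rule distributed_borel_measurable_lborel[OF Z_distr])
  have Z_ind: "indep_vars (\<lambda>_. borel) (Z l) UNIV" for l
    by (rule indep_vars_group[OF W_ind, where K = "\<lambda>t. {emb l t}" and g = "\<lambda>t f. f (emb l t)"])
       (auto simp: disjoint_family_on_def emb_eq_iff Z_def)
  have col_ind: "indep_vars (\<lambda>_. PiM UNIV (\<lambda>_. borel)) (\<lambda>l \<omega> t. Z l t \<omega>) UNIV"
  proof (rule indep_vars_group[OF W_ind, where K = "\<lambda>l. range (emb l)" and g = "\<lambda>l f t. f (emb l t)"])
    show "disjoint_family_on (\<lambda>l. range (emb l)) UNIV"
      by (auto simp: disjoint_family_on_def emb_eq_iff)
    show "(\<lambda>f t. f (emb l t)) \<in> PiM (range (emb l)) (\<lambda>_. borel) \<rightarrow>\<^sub>M PiM UNIV (\<lambda>_. borel :: (real^2) measure)" for l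
      by (rule measurable_PiM_single') (auto simp: space_PiM)
  qed (simp add: Z_def)
  have mean_ind: "indep_vars (\<lambda>_. borel) (\<lambda>l. sample_mean (Z l) n) UNIV"
    and scatter_ind: "indep_vars (\<lambda>_. borel) (\<lambda>l. sample_scatter (Z l) n) UNIV" for n
  proof -
    have "sample_mean (\<lambda>t f. f t) n \<in> PiM UNIV (\<lambda>_. borel :: (real^2) measure) \<rightarrow>\<^sub>M borel"
      "sample_scatter (\<lambda>t f. f t) n \<in> PiM UNIV (\<lambda>_. borel :: (real^2) measure) \<rightarrow>\<^sub>M borel"
      by (auto intro!: sample_mean_measurable sample_scatter_measurable)
    then have "indep_vars (\<lambda>_. borel) (\<lambda>l \<omega>. sample_mean (\<lambda>t f. f t) n (\<lambda>t. Z l t \<omega>)) UNIV"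
      "indep_vars (\<lambda>_. borel) (\<lambda>l \<omega>. sample_scatter (\<lambda>t f. f t) n (\<lambda>t. Z l t \<omega>)) UNIV"
      by (auto intro!: indep_vars_compose2[OF col_ind])
    then show "indep_vars (\<lambda>_. borel) (\<lambda>l. sample_mean (Z l) n) UNIV"
      "indep_vars (\<lambda>_. borel) (\<lambda>l. sample_scatter (Z l) n) UNIV"
      by (simp_all add: sample_mean_def[abs_def] sample_scatter_def[abs_def])
  qed
  have sq_pos: "(\<sigma> j)\<^sup>2 > 0" for j using \<sigma>_pos[of j] by simp
  note sample = gaussian_sample[OF sq_pos Z_ind Z_distr]

  have H_meas: "H l t \<in> borel_measurable M" if "l \<in> I" for l t
  proof -
    have meas: "X t \<theta> \<in> borel_measurable M" if "\<theta> \<in> {-pi..pi}" for \<theta>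
    proof -
      have "(\<lambda>\<omega>. \<Gamma> \<theta> + N t \<theta> \<omega>) \<in> borel_measurable M"
        using N_meas[OF that, of t] by simp
      then show ?thesis by (simp add: X[symmetric])
    qed
    have cont: "continuous_on {-pi..pi} (\<lambda>\<theta>. X t \<theta> \<omega>)" if "\<omega> \<in> space M" for \<omega>
      unfolding X by (intro continuous_on_add \<Gamma>_cont N_cont that)
    have "F t = (\<lambda>j \<omega>. fourier_cos (\<lambda>\<theta>. X t \<theta> \<omega>) j)"
      by (intro ext F)
    moreover have "G t j = (\<lambda>\<omega>. fourier_sin (\<lambda>\<theta>. X t \<theta> \<omega>) j)" if "j \<ge> 1" for j
      by (intro ext G that)
    ultimately show ?thesis
      using \<open>l \<in> I\<close> borel_measurable_fourier_coefficients[of "X t" M, OF meas cont]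
      by (auto simp: I_def H_def)
  qed
  \<comment> \<open>The observed coefficients are translates of the noise vectors, outside a single null set.\<close>
  have H_eq: "AE \<omega> in M. \<forall>l\<in>I. \<forall>t. H l t \<omega> = coef l + Z l t \<omega>"
  proof -
    have "AE \<omega> in M. \<forall>t. \<forall>j. fourier_cos (\<lambda>\<theta>. N t \<theta> \<omega>) j = vector [A t j 1 \<omega>, A t j 2 \<omega>] \<and>
        (j \<ge> 1 \<longrightarrow> fourier_sin (\<lambda>\<theta>. N t \<theta> \<omega>) j = vector [B t j 1 \<omega>, B t j 2 \<omega>])"
      by (subst AE_all_countable, rule allI,
          rule AE_fourier_coefficients_noise[OF A B \<sigma>_pos \<epsilon> series N_cont])
    then show ?thesis
      using AE_space
    proof eventually_elim
      case (elim \<omega>)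
      show ?case
        using elim(1) fourier_coefficients_add[OF \<Gamma>_cont N_cont[OF elim(2)]]
        by (auto simp: I_def H_def coef_def Z_def W_def emb_def F G X \<mu> \<nu>)
    qed
  qed
  \<comment> \<open>By the preceding fact each statistic agrees almost surely with the corresponding statistic of \<open>Z\<close>,
     up to translation, and inherits its law. Measurability of the statistics comes from the observed
     coefficients themselves, as the measure need not be complete.\<close>
  have est: "case_sum (mu_hat n) (nu_hat n) l = sample_mean (H l) n" if "l \<in> I" for l n
    using that by (auto simp: I_def H_def sample_mean_def mu_hat nu_hat)
  have est_meas: "sample_mean (H l) n \<in> borel_measurable M"
    and scatter_meas: "sample_scatter (H l) n \<in> borel_measurable M" if "l \<in> I" for l n
    using H_meas[OF that] by (auto intro!: sample_mean_measurable sample_scatter_measurable)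
  have est_eq: "AE \<omega> in M. coef l + sample_mean (Z l) n \<omega> = sample_mean (H l) n \<omega>"
    and scatter_eq: "AE \<omega> in M. sample_scatter (Z l) n \<omega> = sample_scatter (H l) n \<omega>" if "l \<in> I" for l n
    using H_eq that
    by (auto elim!: eventually_mono intro!: sample_mean_translate[symmetric] sample_scatter_translate[symmetric])

  have est_ind: "indep_vars (\<lambda>_. borel) (case_sum (mu_hat n) (nu_hat n)) I" for n
  proof -
    have "indep_vars (\<lambda>_. borel) (\<lambda>l \<omega>. coef l + sample_mean (Z l) n \<omega>) I"
      by (rule indep_vars_compose2[OF indep_vars_subset[OF mean_ind]]) auto
    then have "indep_vars (\<lambda>_. borel) (\<lambda>l. sample_mean (H l) n) I"
      by (rule indep_vars_cong_AE) (use est_meas est_eq in auto)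
    then show ?thesis
      by (rule indep_vars_cong[THEN iffD1, rotated -1]) (auto simp: est)
  qed
  have est_distr: "distributed M lborel (case_sum (mu_hat n) (nu_hat n) l)
      (mvnormal_density (coef l) (mat ((\<sigma> (ord l))\<^sup>2 / real (n + 1))))" if l: "l \<in> I" for l n
  proof -
    have "distributed M lborel (\<lambda>\<omega>. coef l + sample_mean (Z l) n \<omega>)
        (mvnormal_density (coef l + 0) (mat ((\<sigma> (ord l))\<^sup>2 / real (n + 1))))"
      using sample[of l n] \<sigma>_pos[of "ord l"] by (intro distributed_mvnormal_translate) auto
    then show ?thesis
      unfolding est[OF l] by (intro distributed_cong_AE[OF _ est_meas[OF l] est_eq[OF l]]) simp
  qed
  have est_consistent: "consistent_estimator (\<lambda>n. case_sum (mu_hat n) (nu_hat n) l) (coef l)" if "l \<in> I" for l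
    by (rule consistent_mean[OF est_distr[OF that] sq_pos])

  have var_hat0_eq: "2 * real (n + 1) * var_hat n 0 \<omega> = sample_scatter (H (Inl 0)) n \<omega>" for n \<omega>
    by (simp add: var_hat0 H_def sample_scatter_def sample_mean_def mu_hat)
  have var_hat_eq: "4 * real (n + 1) * var_hat n j \<omega>
      = sample_scatter (H (Inl j)) n \<omega> + sample_scatter (H (Inr j)) n \<omega>" if "j \<ge> 1" for n j \<omega>
    using that by (simp add: var_hat H_def sample_scatter_def sample_mean_def mu_hat nu_hat sum.distrib)
  have inI: "Inl j \<in> I" "j \<ge> 1 \<Longrightarrow> Inr j \<in> I" for j
    by (auto simp: I_def)
  have var0_erlang: "distributed M lborel (\<lambda>\<omega>. 2 * real (n + 1) * var_hat n 0 \<omega> / (\<sigma> 0)\<^sup>2) (erlang_density (n - 1) (1 / 2))"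
    if "n \<ge> 1" for n
  proof (rule distributed_cong_AE)
    show "distributed M lborel (\<lambda>\<omega>. sample_scatter (Z (Inl 0)) n \<omega> / (\<sigma> 0)\<^sup>2) (erlang_density (n - 1) (1 / 2))"
      using sample[of "Inl 0" n] that by (simp add: ord_def)
    show "(\<lambda>\<omega>. 2 * real (n + 1) * var_hat n 0 \<omega> / (\<sigma> 0)\<^sup>2) \<in> borel_measurable M"
      unfolding var_hat0_eq by (intro borel_measurable_divide scatter_meas inI) simp
    show "AE \<omega> in M. sample_scatter (Z (Inl 0)) n \<omega> / (\<sigma> 0)\<^sup>2 = 2 * real (n + 1) * var_hat n 0 \<omega> / (\<sigma> 0)\<^sup>2"
      unfolding var_hat0_eq using scatter_eq[OF inI(1)[of 0], of n] by eventually_elim simp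
  qed
  have var_erlang: "distributed M lborel (\<lambda>\<omega>. 4 * real (n + 1) * var_hat n j \<omega> / (\<sigma> j)\<^sup>2) (erlang_density (2 * n - 1) (1 / 2))"
    if n: "n \<ge> 1" and j: "j \<ge> 1" for n j
  proof (rule distributed_cong_AE)
    let ?S = "\<lambda>l \<omega>. sample_scatter (Z l) n \<omega> / (\<sigma> j)\<^sup>2"
    have "indep_vars (\<lambda>_. borel) ?S UNIV"
      by (rule indep_vars_compose2[OF scatter_ind]) simp
    then have "indep_var borel (?S (Inl j)) borel (?S (Inr j))"
      by (rule indep_vars_imp_indep_var) auto
    then have "distributed M lborel (\<lambda>\<omega>. ?S (Inl j) \<omega> + ?S (Inr j) \<omega>) (erlang_density (Suc (n - 1) + Suc (n - 1) - 1) (1 / 2))"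
      using sample[of "Inl j" n] sample[of "Inr j" n] n by (intro sum_indep_erlang) (auto simp: ord_def)
    then show "distributed M lborel (\<lambda>\<omega>. ?S (Inl j) \<omega> + ?S (Inr j) \<omega>) (erlang_density (2 * n - 1) (1 / 2))"
      using n by (simp add: mult_2)
    show "(\<lambda>\<omega>. 4 * real (n + 1) * var_hat n j \<omega> / (\<sigma> j)\<^sup>2) \<in> borel_measurable M"
      unfolding var_hat_eq[OF j] by (intro borel_measurable_divide borel_measurable_add scatter_meas inI j) simp
    show "AE \<omega> in M. ?S (Inl j) \<omega> + ?S (Inr j) \<omega> = 4 * real (n + 1) * var_hat n j \<omega> / (\<sigma> j)\<^sup>2"
      unfolding var_hat_eq[OF j] using scatter_eq[OF inI(1)[of j], of n] scatter_eq[OF inI(2)[OF j], of n]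
      by eventually_elim (simp add: add_divide_distrib)
  qed
  have var_meas: "var_hat n j \<in> borel_measurable M" for n j
  proof (cases "j = 0")
    case True
    have "(\<lambda>\<omega>. 1 / (2 * real (n + 1)) * sample_scatter (H (Inl 0)) n \<omega>) \<in> borel_measurable M"
      by (intro borel_measurable_times scatter_meas inI) simp
    also have "(\<lambda>\<omega>. 1 / (2 * real (n + 1)) * sample_scatter (H (Inl 0)) n \<omega>) = var_hat n j"
      unfolding var_hat0_eq[symmetric] True by (simp add: fun_eq_iff)
    finally show ?thesis .
  next
    case False
    then have j: "j \<ge> 1" by simp
    have "(\<lambda>\<omega>. 1 / (4 * real (n + 1)) * (sample_scatter (H (Inl j)) n \<omega> + sample_scatter (H (Inr j)) n \<omega>)) \<in> borel_measurable M"
      by (intro borel_measurable_times borel_measurable_add scatter_meas inI j) simp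
    also have "(\<lambda>\<omega>. 1 / (4 * real (n + 1)) * (sample_scatter (H (Inl j)) n \<omega> + sample_scatter (H (Inr j)) n \<omega>)) = var_hat n j"
      unfolding var_hat_eq[OF j, symmetric] by (simp add: fun_eq_iff)
    finally show ?thesis .
  qed
  have var0_consistent: "consistent_estimator (\<lambda>n. var_hat n 0) ((\<sigma> 0)\<^sup>2)"
    by (rule consistent_variance[where k = 1, OF var_meas _ sq_pos]) (use var0_erlang in auto)
  have var_consistent: "consistent_estimator (\<lambda>n. var_hat n j) ((\<sigma> j)\<^sup>2)" if "j \<ge> 1" for j
    by (rule consistent_variance[where k = 2, OF var_meas _ sq_pos]) (use var_erlang that in auto)
  \<comment> \<open>A variable with an Erlang density is almost surely positive, which makes \<open>is_mle_iff\<close> applicable.\<close>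
  have var_pos: "AE \<omega> in M. \<forall>j. var_hat T j \<omega> > 0"
    unfolding AE_all_countable
  proof
    fix j
    have erlang_pos: "AE \<omega> in M. Y \<omega> > 0" if "distributed M lborel Y (erlang_density k (1 / 2))" for Y k
    proof (subst distributed_AE2[OF that])
      show "AE x in lborel. 0 < ennreal (erlang_density k (1 / 2) x) \<longrightarrow> 0 < x"
        using AE_lborel_singleton[of "0 :: real"] by eventually_elim (auto simp: erlang_density_def)
    qed simp
    show "AE \<omega> in M. var_hat T j \<omega> > 0"
    proof (cases "j = 0")
      case True
      show ?thesis
        using erlang_pos[OF var0_erlang[OF T]] unfolding True
        by eventually_elim (simp add: zero_less_divide_iff zero_less_mult_iff not_less[symmetric])
    next
      case False
      then have "AE \<omega> in M. 4 * real (T + 1) * var_hat T j \<omega> / (\<sigma> j)\<^sup>2 > 0"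
        using erlang_pos[OF var_erlang[OF T]] by simp
      then show ?thesis
        by eventually_elim (simp add: zero_less_divide_iff zero_less_mult_iff not_less[symmetric])
    qed
  qed
  have mle: "AE \<omega> in M. \<forall>J\<ge>1. \<forall>m n v.
      is_mle T J (\<lambda>t j. F t j \<omega>) (\<lambda>t j. G t j \<omega>) m n v \<longleftrightarrow>
        (\<forall>j\<le>J. m j = mu_hat T j \<omega>) \<and> (\<forall>j\<in>{1..J}. n j = nu_hat T j \<omega>) \<and> (\<forall>j\<le>J. v j = var_hat T j \<omega>)"
    using var_pos
  proof (eventually_elim, intro allI impI)
    fix \<omega> J m n v assume pos: "\<forall>j. var_hat T j \<omega> > 0"
    have HF: "H (Inl j) = (\<lambda>t. F t j)" and HG: "H (Inr j) = (\<lambda>t. G t j)" for j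
      by (auto simp: H_def)
    have F': "sample_mean (\<lambda>t. F t j) T \<omega> = mu_hat T j \<omega>" for j
      using est[OF inI(1)[of j], of T] by (simp add: HF)
    have G': "sample_mean (\<lambda>t. G t j) T \<omega> = nu_hat T j \<omega>" if "j \<ge> 1" for j
      using est[OF inI(2)[OF that], of T] by (simp add: HG)
    have "is_mle T J (\<lambda>t j. F t j \<omega>) (\<lambda>t j. G t j \<omega>) m n v \<longleftrightarrow>
        (\<forall>j\<le>J. m j = sample_mean (\<lambda>t. F t j) T \<omega>) \<and>
        (\<forall>j\<in>{1..J}. n j = sample_mean (\<lambda>t. G t j) T \<omega>) \<and> (\<forall>j\<le>J. v j = var_hat T j \<omega>)"
      using pos var_hat0_eq[of T \<omega>] var_hat_eq[of _ T \<omega>] by (intro is_mle_iff) (auto simp: HF HG)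
    then show "is_mle T J (\<lambda>t j. F t j \<omega>) (\<lambda>t j. G t j \<omega>) m n v \<longleftrightarrow>
        (\<forall>j\<le>J. m j = mu_hat T j \<omega>) \<and> (\<forall>j\<in>{1..J}. n j = nu_hat T j \<omega>) \<and> (\<forall>j\<le>J. v j = var_hat T j \<omega>)"
      by (simp add: F' G')
  qed
  have chi: "distributed M lborel (\<lambda>\<omega>. 4 * real (T + 1) * var_hat T j \<omega> / (\<sigma> j)\<^sup>2) (chi_square_density (4 * T))"
    if "j \<ge> 1" for j
    using distributed_erlang_imp_chi_square[OF var_erlang[OF T that]] T
    by (simp add: Suc_diff_le[symmetric] del: of_nat_add)
  have chi0: "distributed M lborel (\<lambda>\<omega>. 2 * real (T + 1) * var_hat T 0 \<omega> / (\<sigma> 0)\<^sup>2) (chi_square_density (2 * T))"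
    using distributed_erlang_imp_chi_square[OF var0_erlang[OF T]] T by simp
  show ?thesis
    using mle est_ind[of T, unfolded I_def] est_consistent[OF inI(1)] est_consistent[OF inI(2)]
      est_distr[OF inI(1)] est_distr[OF inI(2)]
      var_consistent chi var0_consistent chi0
    by (simp add: coef_def ord_def)
qed

end
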